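(* Let $K$ be a field, let $a\ge1$, $n\ge1$, $b\ge3$ be integers, and let $G_{a,b,n}=\overline{K}_a\nabla(nB_b)$. The following are equivalent: (i) $G_{a,b,n}$ is well-covered; (ii) $I(G_{a,b,n})$ is unmixed; (iii) the independence complex $\Delta(G_{a,b,n})$ is pure; (iv) $a=2n$.
   Context: All graphs are finite, simple and undirected. For $b\ge 2$, $B_b$ is the graph with vertices $x_1,\dots,x_b,y_1,\dots,y_b$ and edges $\{x_i,x_j\}$ and $\{y_i,y_j\}$ for $1\le i<j\le b$, and $\{x_i,y_i\}$ for $1\le i\le b$. $nB_b$ is the disjoint union of $n$ copies of $B_b$. The join $G\nabla H$ of graphs on disjoint vertex sets is obtained from the disjoint union by adding every edge between $V(G)$ and $V(H)$. $\overline{K}_a$ is the edgeless graph on $a$ vertices. For a graph $G$, $I(G)=(xy:\{x,y\}\in E(G))$ is the edge ideal in the polynomial ring over $K$ on the vertices of $G$; it is unmixed if all its associated primes have the same height (equivalently, all minimal vertex covers of $G$ have the same size). $G$ is well-covered if all its maximal (by inclusion) independent sets have the same size. $\Delta(G)$ is the simplicial complex of independent sets of $G$; it is pure if all facets have the same cardinality. *)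

theory Defs
  imports "HOL-Algebra.Ideal" "HOL-Library.Poly_Mapping" "HOL-Library.Extended_Nat"
begin

record 'v sgraph =
  verts :: "'v set"
  edges :: "'v set set"

definition finite_simple_graph :: "'v sgraph \<Rightarrow> bool" where
  "finite_simple_graph G \<longleftrightarrow>
     finite (verts G) \<and> (\<forall>e \<in> edges G. e \<subseteq> verts G \<and> card e = 2)"

definition edgeless_graph :: "nat \<Rightarrow> nat sgraph" where
  "edgeless_graph a = \<lparr> verts = {1..a}, edges = {} \<rparr>"

text \<open>Here \<open>Inl i\<close> is the vertex \<open>x\<^sub>i\<close> and \<open>Inr i\<close> is the vertex \<open>y\<^sub>i\<close>.\<close>

definition B_graph :: "nat \<Rightarrow> (nat + nat) sgraph" where
  "B_graph b =
     \<lparr> verts = Inl ` {1..b} \<union> Inr ` {1..b},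
       edges = {{Inl i, Inl j} | i j. 1 \<le> i \<and> i < j \<and> j \<le> b}
             \<union> {{Inr i, Inr j} | i j. 1 \<le> i \<and> i < j \<and> j \<le> b}
             \<union> {{Inl i, Inr i} | i. 1 \<le> i \<and> i \<le> b} \<rparr>"

text \<open>The disjoint union of \<open>n\<close> copies; \<open>(k, v)\<close> is the vertex \<open>v\<close> of the \<open>k\<close>-th copy.\<close>

definition copies :: "nat \<Rightarrow> 'v sgraph \<Rightarrow> (nat \<times> 'v) sgraph" where
  "copies n G =
     \<lparr> verts = {1..n} \<times> verts G,
       edges = {Pair k ` e | k e. k \<in> {1..n} \<and> e \<in> edges G} \<rparr>"

text \<open>The sum type makes the two vertex sets disjoint.\<close>

definition graph_join :: "'v sgraph \<Rightarrow> 'w sgraph \<Rightarrow> ('v + 'w) sgraph" where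
  "graph_join G H =
     \<lparr> verts = Inl ` verts G \<union> Inr ` verts H,
       edges = image Inl ` edges G \<union> image Inr ` edges H
             \<union> {{Inl u, Inr v} | u v. u \<in> verts G \<and> v \<in> verts H} \<rparr>"

definition G_graph :: "nat \<Rightarrow> nat \<Rightarrow> nat \<Rightarrow> (nat + nat \<times> (nat + nat)) sgraph" where
  "G_graph a b n = graph_join (edgeless_graph a) (copies n (B_graph b))"

lemma finite_simple_graph_edgeless: "finite_simple_graph (edgeless_graph a)"
  by (simp add: finite_simple_graph_def edgeless_graph_def)

lemma finite_simple_graph_B: "finite_simple_graph (B_graph b)"
  unfolding finite_simple_graph_def B_graph_def
  by (auto simp: card_insert_if)

lemma finite_simple_graph_copies:
  assumes "finite_simple_graph G"
  shows "finite_simple_graph (copies n G)"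
proof -
  have "card (Pair k ` e) = card e" for k :: nat and e :: "'a set"
    by (intro card_image inj_onI) simp
  then show ?thesis
    using assms by (auto simp: finite_simple_graph_def copies_def)
qed

lemma finite_simple_graph_join:
  assumes "finite_simple_graph G" "finite_simple_graph H"
  shows "finite_simple_graph (graph_join G H)"
  using assms
  by (auto simp: finite_simple_graph_def graph_join_def card_image inj_image_mem_iff, blast+)

lemma finite_simple_graph_G: "finite_simple_graph (G_graph a b n)"
  by (simp add: G_graph_def finite_simple_graph_join finite_simple_graph_edgeless
      finite_simple_graph_copies finite_simple_graph_B)

definition independent_set :: "'v sgraph \<Rightarrow> 'v set \<Rightarrow> bool" where
  "independent_set G S \<longleftrightarrow> S \<subseteq> verts G \<and> (\<forall>e \<in> edges G. \<not> e \<subseteq> S)"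

definition maximal_independent_set :: "'v sgraph \<Rightarrow> 'v set \<Rightarrow> bool" where
  "maximal_independent_set G S \<longleftrightarrow>
     independent_set G S \<and> (\<forall>T. independent_set G T \<and> S \<subseteq> T \<longrightarrow> T = S)"

definition well_covered :: "'v sgraph \<Rightarrow> bool" where
  "well_covered G \<longleftrightarrow>
     (\<forall>S T. maximal_independent_set G S \<and> maximal_independent_set G T \<longrightarrow> card S = card T)"

text \<open>A simplicial complex is represented by its set of faces.\<close>

definition independence_complex :: "'v sgraph \<Rightarrow> 'v set set" where
  "independence_complex G = {S. independent_set G S}"

definition facets :: "'v set set \<Rightarrow> 'v set set" where
  "facets D = {F \<in> D. \<forall>F' \<in> D. F \<subseteq> F' \<longrightarrow> F' = F}"

definition pure_complex :: "'v set set \<Rightarrow> bool" where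
  "pure_complex D \<longleftrightarrow> (\<forall>F \<in> facets D. \<forall>F' \<in> facets D. card F = card F')"

text \<open>
  A monomial is a finitely supported exponent function, a polynomial a finitely
  supported coefficient function on monomials; addition and multiplication are those of
  the type class instances for \<^type>\<open>poly_mapping\<close> (multiplication being convolution).
\<close>

type_synonym ('v, 'k) mpoly = "('v \<Rightarrow>\<^sub>0 nat) \<Rightarrow>\<^sub>0 'k"

definition Var :: "'v \<Rightarrow> ('v, 'k :: field) mpoly" where
  "Var v = Poly_Mapping.single (Poly_Mapping.single v 1) 1"

definition indets :: "('v, 'k :: field) mpoly \<Rightarrow> 'v set" where
  "indets p = (\<Union>m \<in> Poly_Mapping.keys p. Poly_Mapping.keys m)"

text \<open>
  The ring \<open>K[v : v \<in> V]\<close>. Restricting the carrier matters: the type \<open>'v\<close> may have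
  elements outside \<open>V\<close>, and these must not become indeterminates.
\<close>

definition poly_ring :: "'v set \<Rightarrow> ('v, 'k :: field) mpoly ring" where
  "poly_ring V =
     \<lparr> carrier = {p. indets p \<subseteq> V}, monoid.mult = (*), one = 1, ring.zero = 0, add = (+) \<rparr>"

lemma indets_zero: "indets 0 = {}"
  by (simp add: indets_def)

lemma indets_one: "indets 1 = {}"
  by (simp add: indets_def)

lemma indets_add: "indets (p + q) \<subseteq> indets p \<union> indets q"
  using keys_add[of p q] by (auto simp: indets_def)

lemma indets_mult: "indets (p * q) \<subseteq> indets p \<union> indets q"
proof
  fix v assume "v \<in> indets (p * q)"
  then obtain m where m: "m \<in> Poly_Mapping.keys (p * q)" "v \<in> Poly_Mapping.keys m"
    by (auto simp: indets_def)
  from m(1) keys_mult[of p q] obtain s t where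
    "m = s + t" "s \<in> Poly_Mapping.keys p" "t \<in> Poly_Mapping.keys q" by blast
  with m(2) keys_add[of s t] show "v \<in> indets p \<union> indets q"
    by (auto simp: indets_def)
qed

lemma indets_uminus: "indets (- p) = indets p"
  by (simp add: indets_def in_keys_iff set_eq_iff)

lemma cring_poly_ring: "cring (poly_ring V :: ('v, 'k :: field) mpoly ring)"
proof (rule cringI)
  show "abelian_group (poly_ring V :: ('v, 'k) mpoly ring)"
  proof (rule abelian_groupI)
    fix p :: "('v, 'k) mpoly" assume "p \<in> carrier (poly_ring V)"
    then show "\<exists>q \<in> carrier (poly_ring V). q \<oplus>\<^bsub>poly_ring V\<^esub> p = \<zero>\<^bsub>poly_ring V\<^esub>"
      by (intro bexI[of _ "- p"]) (simp_all add: poly_ring_def indets_uminus)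
  qed (simp_all add: poly_ring_def indets_zero order_trans[OF indets_add] add_ac)
  show "comm_monoid (poly_ring V :: ('v, 'k) mpoly ring)"
    by (rule comm_monoidI)
      (simp_all add: poly_ring_def indets_one order_trans[OF indets_mult] mult_ac)
qed (simp add: poly_ring_def distrib_right)

definition edge_ideal :: "'v sgraph \<Rightarrow> ('v, 'k :: field) mpoly set" where
  "edge_ideal G =
     genideal (poly_ring (verts G)) {Var x * Var y | x y. {x, y} \<in> edges G}"

text \<open>The associated primes of \<open>I\<close> are those of the module \<open>R/I\<close>: prime ideals \<open>I : f\<close>.\<close>

definition associated_primes :: "('r, 'm) ring_scheme \<Rightarrow> 'r set \<Rightarrow> 'r set set" where
  "associated_primes R I =
     {P. primeideal P R \<and> (\<exists>f \<in> carrier R. P = {g \<in> carrier R. g \<otimes>\<^bsub>R\<^esub> f \<in> I})}"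

text \<open>The supremum of the lengths \<open>k\<close> of chains \<open>Q\<^sub>0 \<subset> \<dots> \<subset> Q\<^sub>k = P\<close> of prime ideals.\<close>

definition prime_height :: "('r, 'm) ring_scheme \<Rightarrow> 'r set \<Rightarrow> enat" where
  "prime_height R P =
     Sup {enat k | k. \<exists>Q :: nat \<Rightarrow> 'r set.
       (\<forall>i \<le> k. primeideal (Q i) R) \<and> (\<forall>i < k. Q i \<subset> Q (Suc i)) \<and> Q k = P}"

definition unmixed :: "('r, 'm) ring_scheme \<Rightarrow> 'r set \<Rightarrow> bool" where
  "unmixed R I \<longleftrightarrow>
     (\<forall>P \<in> associated_primes R I. \<forall>Q \<in> associated_primes R I.
        prime_height R P = prime_height R Q)"

end

theory Submission
  imports Defs
begin

text \<open>
  The associated primes of an edge ideal are the ideals generated by the complements of the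
  maximal independent sets, so unmixedness amounts to well-coveredness once the prime generated
  by \<open>c\<close> variables is known to have height \<open>c\<close>. The upper bound for the height uses no general
  dimension theory: for primes \<open>Q \<subset> P\<close> a set \<open>S\<close> of variables with \<open>K[S] \<inter> P = 0\<close> can be enlarged
  by a variable so that \<open>K[S] \<inter> Q = 0\<close>. Otherwise the residue ring of \<open>Q\<close> would be algebraic
  over \<open>K[S]\<close>, and an element of \<open>P - Q\<close> would satisfy an equation modulo \<open>Q\<close> whose lowest
  coefficient is a nonzero element of \<open>K[S] \<inter> P\<close>. Along a chain of length \<open>k\<close> ending in the
  prime generated by \<open>C \<subseteq> V\<close>, starting with \<open>S = V - C\<close>, this gives \<open>|V - C| + k \<le> |V|\<close>.

  A maximal independent set of the join lies on one side. On the left it consists of all \<open>a\<close>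
  vertices; on the right it meets each copy of \<open>B_graph b\<close> in exactly two vertices \<open>x\<^sub>i, y\<^sub>j\<close>
  with \<open>i \<noteq> j\<close>.
\<close>

section \<open>Polynomial rings and ideals generated by variables\<close>

abbreviation polys :: "'v set \<Rightarrow> ('v, 'k :: field) mpoly set" where
  "polys V \<equiv> {p. indets p \<subseteq> V}"

lemma polys_add: "indets p \<subseteq> V \<Longrightarrow> indets q \<subseteq> V \<Longrightarrow> indets (p + q) \<subseteq> V"
  by (rule order_trans[OF indets_add Un_least])

lemma polys_mult: "indets p \<subseteq> V \<Longrightarrow> indets q \<subseteq> V \<Longrightarrow> indets (p * q) \<subseteq> V"
  by (rule order_trans[OF indets_mult Un_least])

lemma polys_diff: "indets p \<subseteq> V \<Longrightarrow> indets q \<subseteq> V \<Longrightarrow> indets (p - q) \<subseteq> V"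
  using polys_add[of p V "- q"] by (simp add: indets_uminus)

lemma indets_single: "indets (Poly_Mapping.single m c) = (if c = 0 then {} else Poly_Mapping.keys m)"
  by (simp add: indets_def)

lemma indets_Var [simp]: "indets (Var v :: ('v, 'k :: field) mpoly) = {v}"
  by (simp add: Var_def indets_single)

lemma polys_power: "indets p \<subseteq> V \<Longrightarrow> indets (p ^ i) \<subseteq> V"
  by (induction i) (simp_all add: indets_one polys_mult)

lemma polys_sum: "(\<And>i. i \<in> I \<Longrightarrow> indets (f i) \<subseteq> V) \<Longrightarrow> indets (sum f I) \<subseteq> V"
  by (induction I rule: infinite_finite_induct) (simp_all add: indets_zero polys_add)

lemma polys_prod: "(\<And>i. i \<in> I \<Longrightarrow> indets (f i) \<subseteq> V) \<Longrightarrow> indets (prod f I) \<subseteq> V"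
  by (induction I rule: infinite_finite_induct) (simp_all add: indets_one polys_mult)

lemma finite_indets: "finite (indets p)"
  by (simp add: indets_def)

text \<open>Exponents are natural numbers, so nothing cancels, and the inclusion valid for sums in
  general becomes an equality.\<close>

lemma keys_add_nat:
  fixes m m' :: "'v \<Rightarrow>\<^sub>0 nat"
  shows "Poly_Mapping.keys (m + m') = Poly_Mapping.keys m \<union> Poly_Mapping.keys m'"
  by (auto simp: in_keys_iff lookup_add)

lemma poly_mapping_sum_single:
  "p = (\<Sum>m\<in>Poly_Mapping.keys p. Poly_Mapping.single m (Poly_Mapping.lookup p m))"
  by (rule poly_mapping_eqI)
    (auto simp: lookup_sum lookup_single when_def in_keys_iff sum.delta)

text \<open>A monomial arises from a constant by multiplying with one variable at a time (induction
  on its total degree), and a polynomial is a finite sum of monomials.\<close>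

lemma polys_induct [consumes 1, case_names const add var]:
  fixes p :: "('v, 'k :: field) mpoly"
  assumes "indets p \<subseteq> V"
    and const: "\<And>c. P (Poly_Mapping.single 0 c)"
    and add: "\<And>p q. P p \<Longrightarrow> P q \<Longrightarrow> P (p + q)"
    and var: "\<And>v p. v \<in> V \<Longrightarrow> P p \<Longrightarrow> P (Var v * p)"
  shows "P p"
proof -
  have mono: "P (Poly_Mapping.single m c)" if "Poly_Mapping.keys m \<subseteq> V" for m c
    using that
  proof (induction "\<Sum>v\<in>Poly_Mapping.keys m. Poly_Mapping.lookup m v" arbitrary: m rule: less_induct)
    case less
    show ?case
    proof (cases "m = 0")
      case True
      then show ?thesis by (simp add: const)
    next
      case False
      then obtain v where v: "v \<in> Poly_Mapping.keys m"
        by (metis poly_mapping_eqI in_keys_iff lookup_zero)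
      \<comment> \<open>\<open>m'\<close> is \<open>m\<close> divided by \<open>v\<close>; the
        truncated subtraction is exact because \<open>v\<close> occurs in \<open>m\<close>.\<close>
      define m' where "m' = m - Poly_Mapping.single v 1"
      have m: "m = Poly_Mapping.single v 1 + m'"
        using v by (intro poly_mapping_eqI)
          (auto simp: m'_def lookup_add lookup_minus lookup_single when_def in_keys_iff)
      have sub: "Poly_Mapping.keys m' \<subseteq> Poly_Mapping.keys m"
        using arg_cong[OF m, of Poly_Mapping.keys] by (auto simp: keys_add_nat simp del: keys_single)
      have "(\<Sum>u\<in>Poly_Mapping.keys m'. Poly_Mapping.lookup m' u)
          = (\<Sum>u\<in>Poly_Mapping.keys m. Poly_Mapping.lookup m' u)"
        using sub by (intro sum.mono_neutral_left) (auto simp: in_keys_iff)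
      also have "\<dots> < (\<Sum>u\<in>Poly_Mapping.keys m. Poly_Mapping.lookup m u)"
        using v by (intro sum_strict_mono_ex1)
          (auto simp: m'_def lookup_minus lookup_single in_keys_iff intro!: bexI[of _ v])
      finally have "P (Poly_Mapping.single m' c)"
        using less sub by blast
      then have "P (Var v * Poly_Mapping.single m' c)"
        using var v less.prems by blast
      then show ?thesis
        by (subst m) (simp add: Var_def mult_single)
    qed
  qed
  have "P (\<Sum>m\<in>A. Poly_Mapping.single m (Poly_Mapping.lookup p m))"
    if "A \<subseteq> Poly_Mapping.keys p" for A
    using finite_subset[OF that finite_keys] that
  proof (induction rule: finite_induct)
    case empty
    then show ?case using const[of 0] by simp
  next
    case (insert m A)
    then show ?case
      using assms(1) by (auto intro!: add mono simp: indets_def)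
  qed
  then show ?thesis
    by (subst poly_mapping_sum_single) simp
qed

text \<open>For a total order on monomials compatible with multiplication, the product of the
  leading terms cannot be cancelled, and its coefficient is a product of two nonzero field
  elements.\<close>

lemma mpoly_mult_nonzero:
  fixes p q :: "('v, 'k :: field) mpoly"
  assumes "p \<noteq> 0" "q \<noteq> 0"
  shows "p * q \<noteq> 0"
proof -
  define U where "U = indets p \<union> indets q"
  have U: "finite U" by (simp add: U_def finite_indets)
  then obtain f :: "'v \<Rightarrow> nat" where f: "inj_on f U"
    using finite_imp_inj_to_nat_seg[OF U] by metis
  txt \<open>The type of variables carries no order, so monomials are compared after renaming the
    finitely many variables involved to natural numbers.\<close>
  define W where "W m = (\<Sum>v\<in>U. Poly_Mapping.single (f v) (Poly_Mapping.lookup m v))"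
    for m :: "'v \<Rightarrow>\<^sub>0 nat"
  have W_add: "W (m + m') = W m + W m'" for m m'
    by (simp add: W_def lookup_add single_add sum.distrib)
  have W_inj: "m = m'" if "Poly_Mapping.keys m \<subseteq> U" "Poly_Mapping.keys m' \<subseteq> U" "W m = W m'" for m m'
  proof (rule poly_mapping_eqI)
    fix v
    have W_lookup: "Poly_Mapping.lookup (W m) (f v) = Poly_Mapping.lookup m v" if "v \<in> U" for m
    proof -
      have "Poly_Mapping.lookup (W m) (f v)
          = (\<Sum>u\<in>U. if u = v then Poly_Mapping.lookup m u else 0)"
        unfolding W_def lookup_sum using that inj_onD[OF f]
        by (intro sum.cong) (auto simp: lookup_single when_def)
      then show ?thesis using that U by simp
    qed
    show "Poly_Mapping.lookup m v = Poly_Mapping.lookup m' v"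
    proof (cases "v \<in> U")
      case True
      then show ?thesis using W_lookup[of m] W_lookup[of m'] that by simp
    next
      case False
      then show ?thesis using that by (metis in_keys_iff subsetD)
    qed
  qed
  \<comment> \<open>\<open>W\<close> is injective on monomials in \<open>U\<close>, so its maximum
    over the monomials of \<open>r\<close> is attained only once.\<close>
  have top: "\<exists>m\<in>Poly_Mapping.keys r. \<forall>m'\<in>Poly_Mapping.keys r. m' \<noteq> m \<longrightarrow> W m' < W m"
    if r: "r \<noteq> 0" "indets r \<subseteq> U" for r :: "('v, 'k) mpoly"
  proof -
    have "W ` Poly_Mapping.keys r \<noteq> {}" "finite (W ` Poly_Mapping.keys r)"
      using r by (auto simp: poly_mapping_eq_iff fun_eq_iff in_keys_iff ex_in_conv[symmetric] )
    then obtain m where m: "m \<in> Poly_Mapping.keys r" "W m = Max (W ` Poly_Mapping.keys r)"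
      by (metis Max_in imageE)
    then have "W m' < W m" if "m' \<in> Poly_Mapping.keys r" "m' \<noteq> m" for m'
      using that W_inj[of m' m] r by (auto simp: indets_def order.strict_iff_order)
    with m show ?thesis by blast
  qed
  obtain m where m: "m \<in> Poly_Mapping.keys p"
    "\<And>m'. m' \<in> Poly_Mapping.keys p \<Longrightarrow> m' \<noteq> m \<Longrightarrow> W m' < W m"
    using top[of p] assms by (auto simp: U_def)
  obtain n where n: "n \<in> Poly_Mapping.keys q"
    "\<And>n'. n' \<in> Poly_Mapping.keys q \<Longrightarrow> n' \<noteq> n \<Longrightarrow> W n' < W n"
    using top[of q] assms by (auto simp: U_def)
  define c d where "c = Poly_Mapping.lookup p m" and "d = Poly_Mapping.lookup q n"
  define p' q' where "p' = p - Poly_Mapping.single m c" and "q' = q - Poly_Mapping.single n d"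
  have p': "W m' < W m" if "m' \<in> Poly_Mapping.keys p'" for m'
    using that m(2)[of m'] by (auto simp: p'_def c_def in_keys_iff lookup_minus lookup_single when_def split: if_splits)
  have q': "W n' < W n" if "n' \<in> Poly_Mapping.keys q'" for n'
    using that n(2)[of n'] by (auto simp: q'_def d_def in_keys_iff lookup_minus lookup_single when_def split: if_splits)
  \<comment> \<open>With the leading terms split off, every monomial of the three remaining products
    has a strictly smaller image under \<open>W\<close> than \<open>m + n\<close>.\<close>
  have "p * q = Poly_Mapping.single (m + n) (c * d)
      + (Poly_Mapping.single m c * q' + p' * Poly_Mapping.single n d + p' * q')"
    by (simp add: p'_def q'_def algebra_simps mult_single)
  moreover have "m + n \<notin> Poly_Mapping.keys (Poly_Mapping.single m c * q')"
    using keys_mult[of "Poly_Mapping.single m c" q'] q' by (fastforce split: if_splits)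
  moreover have "m + n \<notin> Poly_Mapping.keys (p' * Poly_Mapping.single n d)"
    using keys_mult[of p' "Poly_Mapping.single n d"] p' by (fastforce split: if_splits)
  moreover have "m + n \<notin> Poly_Mapping.keys (p' * q')"
  proof
    assume "m + n \<in> Poly_Mapping.keys (p' * q')"
    then obtain s t where "m + n = s + t" "s \<in> Poly_Mapping.keys p'" "t \<in> Poly_Mapping.keys q'"
      using keys_mult[of p' q'] by blast
    then show False
      using add_strict_mono[OF p' q'] W_add by (metis less_irrefl)
  qed
  ultimately have "Poly_Mapping.lookup (p * q) (m + n) = c * d"
    by (simp add: lookup_add in_keys_iff)
  also have "\<dots> \<noteq> 0"
    using m(1) n(1) by (simp add: c_def d_def in_keys_iff)
  finally show ?thesis by auto
qed

lemma mpoly_mult_eq_0_iff: "p * q = 0 \<longleftrightarrow> p = 0 \<or> q = 0" for p q :: "('v, 'k :: field) mpoly"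
  using mpoly_mult_nonzero by auto

section \<open>Ideals and primes of the polynomial ring as sets of polynomials\<close>

text \<open>These closure conditions replace the record-based notion of ideal in the later
  arguments. Negation is covered as multiplication by the constant -1.\<close>

lemma ideal_poly_ring_iff:
  fixes I :: "('v, 'k :: field) mpoly set"
  shows "ideal I (poly_ring V) \<longleftrightarrow> I \<subseteq> polys V \<and> 0 \<in> I \<and> (\<forall>p\<in>I. \<forall>q\<in>I. p + q \<in> I) \<and>
    (\<forall>p\<in>I. \<forall>r\<in>polys V. r * p \<in> I)"
proof
  assume "ideal I (poly_ring V)"
  then interpret ideal I "poly_ring V" .
  show "I \<subseteq> polys V \<and> 0 \<in> I \<and> (\<forall>p\<in>I. \<forall>q\<in>I. p + q \<in> I) \<and> (\<forall>p\<in>I. \<forall>r\<in>polys V. r * p \<in> I)"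
    using a_subset additive_subgroup.zero_closed[OF additive_subgroup_axioms]
      additive_subgroup.a_closed[OF additive_subgroup_axioms] I_l_closed
    by (auto simp: poly_ring_def)
next
  assume I: "I \<subseteq> polys V \<and> 0 \<in> I \<and> (\<forall>p\<in>I. \<forall>q\<in>I. p + q \<in> I) \<and> (\<forall>p\<in>I. \<forall>r\<in>polys V. r * p \<in> I)"
  interpret cring "poly_ring V :: ('v, 'k) mpoly ring" by (rule cring_poly_ring)
  have minus: "- p \<in> I" if "p \<in> I" for p
    using I that by (metis (no_types) indets_one indets_uminus empty_subsetI mem_Collect_eq mult_minus1)
  show "ideal I (poly_ring V)"
  proof (rule idealI)
    show "subgroup I (add_monoid (poly_ring V))"
    proof (rule add.subgroupI)
      fix p assume p: "p \<in> I"
      have "\<ominus>\<^bsub>poly_ring V\<^esub> p = - p"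
        using I p by (intro minus_equality) (auto simp: poly_ring_def indets_uminus)
      then show "\<ominus>\<^bsub>poly_ring V\<^esub> p \<in> I"
        using minus p by simp
    qed (use I in \<open>auto simp: poly_ring_def\<close>)
  qed (use I in \<open>auto simp: poly_ring_def ring_axioms mult.commute\<close>, rule ring_axioms[unfolded poly_ring_def])
qed

lemma primeideal_poly_ring_iff:
  fixes P :: "('v, 'k :: field) mpoly set"
  shows "primeideal P (poly_ring V) \<longleftrightarrow> ideal P (poly_ring V) \<and> 1 \<notin> P \<and>
    (\<forall>p\<in>polys V. \<forall>q\<in>polys V. p * q \<in> P \<longrightarrow> p \<in> P \<or> q \<in> P)"
proof
  assume "primeideal P (poly_ring V)"
  then interpret primeideal P "poly_ring V" .
  show "ideal P (poly_ring V) \<and> 1 \<notin> P \<and> (\<forall>p\<in>polys V. \<forall>q\<in>polys V. p * q \<in> P \<longrightarrow> p \<in> P \<or> q \<in> P)"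
    using one_imp_carrier I_notcarr I_prime ideal_axioms by (auto simp: poly_ring_def)
next
  assume "ideal P (poly_ring V) \<and> 1 \<notin> P \<and> (\<forall>p\<in>polys V. \<forall>q\<in>polys V. p * q \<in> P \<longrightarrow> p \<in> P \<or> q \<in> P)"
  then show "primeideal P (poly_ring V)"
    by (intro primeidealI cring_poly_ring) (auto simp: poly_ring_def indets_one)
qed

text \<open>This is the ideal generated by the variables in \<open>C \<inter> V\<close>. Being a
  monomial ideal, it is described by a condition on the support of each monomial.\<close>

definition var_ideal :: "'v set \<Rightarrow> 'v set \<Rightarrow> ('v, 'k :: field) mpoly set" where
  "var_ideal V C = {p \<in> polys V. \<forall>m\<in>Poly_Mapping.keys p. Poly_Mapping.keys m \<inter> C \<noteq> {}}"

lemma ideal_var_ideal: "ideal (var_ideal V C :: ('v, 'k :: field) mpoly set) (poly_ring V)"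
  unfolding ideal_poly_ring_iff
proof (intro conjI ballI)
  fix p q :: "('v, 'k) mpoly" assume "p \<in> var_ideal V C" "q \<in> var_ideal V C"
  then show "p + q \<in> var_ideal V C"
    using keys_add[of p q] by (auto simp: var_ideal_def polys_add)
next
  fix p r :: "('v, 'k) mpoly" assume "p \<in> var_ideal V C" "r \<in> polys V"
  then show "r * p \<in> var_ideal V C"
    using keys_mult[of r p] by (fastforce simp: var_ideal_def polys_mult keys_add_nat)
qed (auto simp: var_ideal_def indets_zero)

text \<open>Let \<phi> set the variables in \<open>C\<close> to zero, that is, drop every term
  containing one of them. The ideal is the kernel of \<phi>, and the values of \<phi> are
  polynomials, which have no zero divisors.\<close>

lemma primeideal_var_ideal: "primeideal (var_ideal V C :: ('v, 'k :: field) mpoly set) (poly_ring V)"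
  unfolding primeideal_poly_ring_iff
proof (intro conjI ballI impI ideal_var_ideal)
  show "1 \<notin> (var_ideal V C :: ('v, 'k) mpoly set)"
    by (simp add: var_ideal_def)
next
  fix p q :: "('v, 'k) mpoly"
  assume p: "p \<in> polys V" and q: "q \<in> polys V" and pq: "p * q \<in> var_ideal V C"
  define \<phi> :: "('v, 'k) mpoly \<Rightarrow> ('v, 'k) mpoly" where
    "\<phi> = Poly_Mapping.mapp (\<lambda>m c. c when Poly_Mapping.keys m \<inter> C = {})"
  have lookup_\<phi>: "Poly_Mapping.lookup (\<phi> r) m =
      (if Poly_Mapping.keys m \<inter> C = {} then Poly_Mapping.lookup r m else 0)" for r m
    by (auto simp: \<phi>_def lookup_mapp when_def in_keys_iff[of m r])
  have keys_\<phi>: "Poly_Mapping.keys (\<phi> r) = {m \<in> Poly_Mapping.keys r. Poly_Mapping.keys m \<inter> C = {}}" for r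
    unfolding set_eq_iff mem_Collect_eq in_keys_iff[of _ "\<phi> r"] in_keys_iff[of _ r] lookup_\<phi> by simp
  have \<phi>: "r - \<phi> r \<in> var_ideal V C" "\<phi> r \<in> polys V" if "r \<in> polys V" for r
  proof -
    show *: "\<phi> r \<in> polys V"
      using that by (auto simp: indets_def keys_\<phi>)
    have "Poly_Mapping.keys m \<inter> C \<noteq> {}" if "m \<in> Poly_Mapping.keys (r - \<phi> r)" for m
      using that unfolding in_keys_iff[of m] lookup_minus lookup_\<phi> by auto
    then show "r - \<phi> r \<in> var_ideal V C"
      using * that by (simp add: var_ideal_def polys_diff)
  qed
  note I = ideal_var_ideal[of V C, where 'k = 'k, unfolded ideal_poly_ring_iff]
  \<comment> \<open>Multiples of \<open>p - \<phi> p\<close> and \<open>q - \<phi> q\<close> are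
    subtracted from \<open>p * q\<close> so that exactly \<open>\<phi> p * \<phi> q\<close>
    remains.\<close>
  have "p * q + ((- q) * (p - \<phi> p) + (- \<phi> p) * (q - \<phi> q)) \<in> var_ideal V C"
    using I pq \<phi> p q by (metis (no_types, lifting) indets_uminus mem_Collect_eq)
  also have "p * q + ((- q) * (p - \<phi> p) + (- \<phi> p) * (q - \<phi> q)) = \<phi> p * \<phi> q"
    by (simp add: algebra_simps)
  finally have "\<phi> p * \<phi> q \<in> var_ideal V C" .
  \<comment> \<open>No monomial of this product contains a variable of \<open>C\<close>, but every
    monomial of a member of the ideal does.\<close>
  then have "\<phi> p * \<phi> q = 0"
    using keys_mult[of "\<phi> p" "\<phi> q"]
    by (force simp: var_ideal_def keys_\<phi> keys_add_nat Int_Un_distrib2 simp flip: keys_eq_empty)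
  then have "\<phi> p = 0 \<or> \<phi> q = 0"
    by (simp add: mpoly_mult_eq_0_iff)
  then show "p \<in> var_ideal V C \<or> q \<in> var_ideal V C"
    using \<phi> p q by (metis diff_zero)
qed

section \<open>Linear dependence over a domain, and expansion in powers of one variable\<close>

text \<open>A homogeneous linear system with more unknowns \<open>a j\<close> than equations
  \<open>b\<close> is solved by division-free Gaussian elimination, which keeps everything inside
  \<open>D\<close>. The domain is a subset of a ring because it will be
  \<open>polys S\<close>.\<close>

lemma exists_linear_dependence:
  fixes d :: "'i \<Rightarrow> 'j \<Rightarrow> 'a :: comm_ring_1"
  assumes one: "1 \<in> D" and diff: "\<And>x y. x \<in> D \<Longrightarrow> y \<in> D \<Longrightarrow> x - y \<in> D"
    and mult: "\<And>x y. x \<in> D \<Longrightarrow> y \<in> D \<Longrightarrow> x * y \<in> D"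
    and domain: "\<And>x y. x \<in> D \<Longrightarrow> y \<in> D \<Longrightarrow> x * y = 0 \<Longrightarrow> x = 0 \<or> y = 0"
    and "finite B" "finite J" "card B < card J"
    and d: "\<And>j b. j \<in> J \<Longrightarrow> b \<in> B \<Longrightarrow> d j b \<in> D"
  shows "\<exists>a. (\<forall>j\<in>J. a j \<in> D) \<and> (\<exists>j\<in>J. a j \<noteq> 0) \<and> (\<forall>b\<in>B. (\<Sum>j\<in>J. a j * d j b) = 0)"
  using \<open>finite B\<close> assms(6-)
proof (induction B arbitrary: J d rule: finite_induct)
  case empty
  then obtain j where "j \<in> J" by fastforce
  then show ?case
    using one by (intro exI[of _ "\<lambda>_. 1"]) auto
next
  case (insert b\<^sub>0 B)
  have zero: "0 \<in> D" using diff[OF one one] by simp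
  have uminus: "- x \<in> D" if "x \<in> D" for x using diff[OF zero that] by simp
  have sum: "sum f A \<in> D" if "\<And>i. i \<in> A \<Longrightarrow> f i \<in> D" for f :: "'i \<Rightarrow> 'a" and A
    using that
  proof (induction A rule: infinite_finite_induct)
    case (insert i A)
    then have "f i - (0 - sum f A) \<in> D" by (intro diff zero) auto
    then show ?case using insert by simp
  qed (simp_all add: zero)
  show ?case
  proof (cases "\<forall>j\<in>J. d j b\<^sub>0 = 0")
    case True
    have "card B < card J" using insert by simp
    with insert.IH[of J d] insert.prems True show ?thesis by auto
  next
    case False
    then obtain j\<^sub>0 where j\<^sub>0: "j\<^sub>0 \<in> J" "d j\<^sub>0 b\<^sub>0 \<noteq> 0" by blast
    define p where "p = d j\<^sub>0 b\<^sub>0"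
    have p: "p \<in> D" "p \<noteq> 0" using j\<^sub>0 insert.prems(3) by (auto simp: p_def)
    define J' where "J' = J - {j\<^sub>0}"
    have J: "J = insert j\<^sub>0 J'" "j\<^sub>0 \<notin> J'" "finite J'" using j\<^sub>0 insert.prems by (auto simp: J'_def)
    \<comment> \<open>Equation \<open>b\<close> after eliminating the unknown at
      \<open>j\<^sub>0\<close> with equation \<open>b\<^sub>0\<close>, cross-multiplied by the pivot
      \<open>p\<close> instead of divided by it.\<close>
    define d' where "d' j b = p * d j b - d j b\<^sub>0 * d j\<^sub>0 b" for j b
    have "card B < card J'" using insert.prems insert.hyps J by simp
    moreover have "d' j b \<in> D" if "j \<in> J'" "b \<in> B" for j b
      using that J p insert.prems(3) by (auto simp: d'_def intro!: diff mult)
    ultimately obtain a where a: "\<forall>j\<in>J'. a j \<in> D" "\<exists>j\<in>J'. a j \<noteq> 0"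
      "\<And>b. b \<in> B \<Longrightarrow> (\<Sum>j\<in>J'. a j * d' j b) = 0"
      using insert.IH[of J' d'] J(3) by metis
    \<comment> \<open>Back substitution: scaling the other unknowns by \<open>p\<close> lets
      equation \<open>b\<^sub>0\<close> be solved at \<open>j\<^sub>0\<close> without
      division.\<close>
    define a' where "a' j = (if j = j\<^sub>0 then - (\<Sum>j\<in>J'. a j * d j b\<^sub>0) else p * a j)" for j
    have sum_a': "(\<Sum>j\<in>J. a' j * d j b)
        = (\<Sum>j\<in>J'. p * a j * d j b) - (\<Sum>j\<in>J'. a j * d j b\<^sub>0) * d j\<^sub>0 b" for b
      using J by (auto simp: a'_def intro!: sum.cong)
    have "(\<Sum>j\<in>J. a' j * d j b) = 0" if "b \<in> insert b\<^sub>0 B" for b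
    proof (cases "b = b\<^sub>0")
      case True
      then show ?thesis
        unfolding sum_a' by (simp add: p_def sum_distrib_left sum_distrib_right mult_ac)
    next
      case False
      have "(\<Sum>j\<in>J. a' j * d j b) = (\<Sum>j\<in>J'. a j * d' j b)"
        unfolding sum_a' d'_def by (simp add: sum_distrib_left algebra_simps sum_subtractf)
      then show ?thesis using a(3) that False by simp
    qed
    moreover have "\<forall>j\<in>J. a' j \<in> D"
      using J a p insert.prems(3) by (auto simp: a'_def intro!: mult uminus sum)
    moreover have "\<exists>j\<in>J. a' j \<noteq> 0"
    proof -
      obtain j where j: "j \<in> J'" "a j \<noteq> 0" using a by blast
      then have "a' j \<noteq> 0" using domain[of p "a j"] p a J by (auto simp: a'_def)
      then show ?thesis using j J by blast
    qed
    ultimately show ?thesis by blast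
  qed
qed

text \<open>Sorting the terms by powers of \<open>v\<close> turns \<open>p\<close> into a polynomial
  in one variable over \<open>K[S]\<close>. The bound \<open>n\<close> need not be sharp, since
  coefficients may vanish.\<close>

lemma polys_insert_expansion:
  assumes "indets p \<subseteq> insert v S"
  shows "\<exists>n f. (\<forall>i. indets (f i) \<subseteq> S) \<and> p = (\<Sum>i<n::nat. f i * Var v ^ i)"
  using assms
proof (induction p rule: polys_induct)
  case (const c)
  show ?case
    by (intro exI[of _ 1] exI[of _ "\<lambda>_. Poly_Mapping.single 0 c"]) (simp add: indets_single)
next
  case (add p q)
  then obtain n f m g where f: "\<forall>i. indets (f i) \<subseteq> S" "p = (\<Sum>i<n::nat. f i * Var v ^ i)"
    and g: "\<forall>i. indets (g i) \<subseteq> S" "q = (\<Sum>i<m::nat. g i * Var v ^ i)" by blast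
  define h where "h i = (if i < n then f i else 0) + (if i < m then g i else 0)" for i
  have "p = (\<Sum>i<max n m. (if i < n then f i else 0) * Var v ^ i)"
    unfolding f by (rule sum.mono_neutral_cong_left) auto
  moreover have "q = (\<Sum>i<max n m. (if i < m then g i else 0) * Var v ^ i)"
    unfolding g by (rule sum.mono_neutral_cong_left) auto
  ultimately have "p + q = (\<Sum>i<max n m. h i * Var v ^ i)"
    by (simp add: h_def distrib_right sum.distrib)
  moreover have "\<forall>i. indets (h i) \<subseteq> S"
    using f g by (simp add: h_def indets_zero polys_add)
  ultimately show ?case by blast
next
  case (var u p)
  then obtain n f where f: "\<forall>i. indets (f i) \<subseteq> S" "p = (\<Sum>i<n::nat. f i * Var v ^ i)" by blast
  show ?case
  proof (cases "u = v")
    case True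
    have "Var u * p = (\<Sum>i<n. f i * Var v ^ Suc i)"
      unfolding f True by (simp add: sum_distrib_left mult_ac)
    \<comment> \<open>Multiplication by \<open>v\<close> shifts the coefficients by one place and
      puts 0 in the constant place.\<close>
    also have "\<dots> = (\<Sum>i<Suc n. (case i of 0 \<Rightarrow> 0 | Suc j \<Rightarrow> f j) * Var v ^ i)"
      by (simp only: sum.lessThan_Suc_shift) simp
    finally show ?thesis
      using f by (intro exI[of _ "Suc n"] exI[of _ "\<lambda>i. case i of 0 \<Rightarrow> 0 | Suc j \<Rightarrow> f j"])
        (auto simp: indets_zero split: nat.split)
  next
    case False
    then have "indets (Var u * f i) \<subseteq> S" for i
      using f var.hyps by (intro polys_mult) auto
    then show ?thesis
      using f by (intro exI[of _ n] exI[of _ "\<lambda>i. Var u * f i"]) (simp add: sum_distrib_left mult_ac)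
  qed
qed

section \<open>Heights of primes generated by variables\<close>

text \<open>Interpreting the locale gives closure facts under separate prefixes, so two primes can
  be handled side by side.\<close>

locale poly_prime =
  fixes V :: "'v set" and Q :: "('v, 'k :: field) mpoly set"
  assumes prime: "primeideal Q (poly_ring V)"
begin

lemma sub: "p \<in> Q \<Longrightarrow> indets p \<subseteq> V"
  and zero: "0 \<in> Q"
  and add: "p \<in> Q \<Longrightarrow> q \<in> Q \<Longrightarrow> p + q \<in> Q"
  and mult: "p \<in> Q \<Longrightarrow> indets r \<subseteq> V \<Longrightarrow> r * p \<in> Q"
  and one: "1 \<notin> Q"
  and primeD: "p * q \<in> Q \<Longrightarrow> indets p \<subseteq> V \<Longrightarrow> indets q \<subseteq> V \<Longrightarrow> p \<in> Q \<or> q \<in> Q"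
  using prime unfolding primeideal_poly_ring_iff ideal_poly_ring_iff by auto

lemma uminus: "p \<in> Q \<Longrightarrow> - p \<in> Q"
  using mult[of p "- 1"] by (simp add: indets_uminus indets_one)

lemma diff: "p \<in> Q \<Longrightarrow> q \<in> Q \<Longrightarrow> p - q \<in> Q"
  using add[of p "- q"] uminus by simp

lemma sum: "(\<And>i. i \<in> I \<Longrightarrow> f i \<in> Q) \<Longrightarrow> sum f I \<in> Q"
  by (induction I rule: infinite_finite_induct) (simp_all add: zero add)

lemma powerD: "p ^ i \<in> Q \<Longrightarrow> indets p \<subseteq> V \<Longrightarrow> p \<in> Q"
  by (induction i) (use one in \<open>auto dest!: primeD dest: subsetD[OF polys_power]\<close>)

text \<open>If every further variable is algebraic over \<open>K[S]\<close> modulo \<open>Q\<close>, then after clearing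
  denominators finitely many monomials span the residue ring over \<open>K[S]\<close>.\<close>

lemma finite_span:
  assumes "finite V" "S \<subseteq> V" and indep: "polys S \<inter> Q \<subseteq> {0}"
    and alg: "\<And>v. v \<in> V - S \<Longrightarrow> \<exists>p. p \<in> polys (insert v S) \<inter> Q \<and> p \<noteq> 0"
  obtains B :: "('v \<Rightarrow> nat) set" and \<beta> :: "('v \<Rightarrow> nat) \<Rightarrow> ('v, 'k) mpoly" where "finite B"
    "\<And>f. indets f \<subseteq> V \<Longrightarrow> \<exists>c d. indets c \<subseteq> S \<and> c \<noteq> 0 \<and> (\<forall>e. indets (d e) \<subseteq> S)
       \<and> c * f - (\<Sum>e\<in>B. d e * \<beta> e) \<in> Q"
proof -
  \<comment> \<open>The form in which algebraicity is used: modulo \<open>Q\<close>, a power of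
    \<open>v\<close> with a nonzero coefficient in \<open>K[S]\<close> reduces to lower powers of
    \<open>v\<close>.\<close>
  define R where "R v n c d \<longleftrightarrow> indets c \<subseteq> S \<and> c \<noteq> 0 \<and> 0 < n \<and> (\<forall>i. indets (d i) \<subseteq> S) \<and>
      c * Var v ^ n - (\<Sum>i<n::nat. d i * Var v ^ i) \<in> Q" for v n c d
  have "\<exists>n c d. R v n c d" if v: "v \<in> V - S" for v
  proof -
    obtain p where p: "indets p \<subseteq> insert v S" "p \<in> Q" "p \<noteq> 0"
      using alg[OF v] by blast
    obtain N f where f: "\<And>i. indets (f i) \<subseteq> S" "p = (\<Sum>i<N::nat. f i * Var v ^ i)"
      using polys_insert_expansion[OF p(1)] by blast
    \<comment> \<open>The highest power of \<open>v\<close> with a nonzero coefficient in the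
      expansion of \<open>p\<close>.\<close>
    define n where "n = Max {i. i < N \<and> f i \<noteq> 0}"
    have "{i. i < N \<and> f i \<noteq> 0} \<noteq> {}"
      using p f by (auto intro: sum.neutral)
    then have "n \<in> {i. i < N \<and> f i \<noteq> 0}"
      unfolding n_def by (intro Max_in) auto
    then have n: "n < N" "f n \<noteq> 0" by auto
    have "f i = 0" if "i < N" "n < i" for i
      using that Max_ge[of "{i. i < N \<and> f i \<noteq> 0}" i] unfolding n_def[symmetric] by auto
    then have "p = (\<Sum>i<Suc n. f i * Var v ^ i)"
      unfolding f(2) using n by (intro sum.mono_neutral_right) auto
    then have p_eq: "p = f n * Var v ^ n - (\<Sum>i<n. - f i * Var v ^ i)"
      by (simp add: sum_negf)
    \<comment> \<open>Otherwise \<open>p\<close> would be a nonzero element of \<open>K[S]\<close>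
      lying in \<open>Q\<close>.\<close>
    have "n \<noteq> 0"
    proof
      assume "n = 0"
      then have "p = f 0" using p_eq by simp
      then have "p \<in> polys S" using f(1) by simp
      then show False using p indep by auto
    qed
    then show ?thesis
      using n f(1) p(2) p_eq unfolding R_def
      by (intro exI[of _ n] exI[of _ "f n"] exI[of _ "\<lambda>i. - f i"]) (simp add: indets_uminus)
  qed
  then obtain n c d where "R v (n v) (c v) (d v)" if "v \<in> V - S" for v by metis
  then have c: "\<And>v. v \<in> V - S \<Longrightarrow> indets (c v) \<subseteq> S"
      "\<And>v. v \<in> V - S \<Longrightarrow> c v \<noteq> 0" "\<And>v. v \<in> V - S \<Longrightarrow> 0 < n v"
    and d: "\<And>v i. v \<in> V - S \<Longrightarrow> indets (d v i) \<subseteq> S"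
    and rel: "\<And>v. v \<in> V - S \<Longrightarrow> c v * Var v ^ n v - (\<Sum>i<n v::nat. d v i * Var v ^ i) \<in> Q"
    unfolding R_def by auto
  \<comment> \<open>The spanning monomials involve only variables outside \<open>S\<close>, each
    with an exponent below the power \<open>n v\<close> that can be reduced.\<close>
  define B where "B = (\<Pi>\<^sub>E v\<in>V - S. {..<n v})"
  define \<beta> where "\<beta> e = (\<Prod>v\<in>V - S. Var v ^ e v :: ('v, 'k) mpoly)" for e :: "'v \<Rightarrow> nat"
  have B: "finite B" unfolding B_def using assms(1) by (intro finite_PiE) auto
  define spanned where "spanned f c d \<longleftrightarrow> indets c \<subseteq> S \<and> c \<noteq> 0 \<and> (\<forall>e. indets (d e) \<subseteq> S)
      \<and> c * f - (\<Sum>e\<in>B. d e * \<beta> e) \<in> Q" for f c d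
  \<comment> \<open>\<open>F\<close> consists of the polynomials that fall into the span modulo
    \<open>Q\<close> after multiplication by a nonzero element of \<open>K[S]\<close>. It contains
    the constants and is closed under addition and under multiplication by variables, hence it is
    everything.\<close>
  define F where "F = {f. indets f \<subseteq> V \<and> (\<exists>c d. spanned f c d)}"
  have F_I: "f \<in> F" if "indets f \<subseteq> V" "spanned f c d" for f c d
    using that by (auto simp: F_def)
  have \<beta>: "indets (\<beta> e) \<subseteq> V" for e
    unfolding \<beta>_def by (intro polys_prod polys_power) auto
  have SV: "indets p \<subseteq> V" if "indets p \<subseteq> S" for p :: "('v, 'k) mpoly"
    using that assms(2) by blast
  have F_Q: "f \<in> F" if "f \<in> Q" for f
    using that sub by (intro F_I[of f 1 "\<lambda>_. 0"]) (simp_all add: spanned_def indets_one indets_zero)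
  have F_\<beta>: "\<beta> e \<in> F" if "e \<in> B" for e
  proof -
    have "(\<Sum>e'\<in>B. (if e' = e then 1 else 0) * \<beta> e') = (\<Sum>e'\<in>B. if e' = e then \<beta> e' else 0)"
      by (intro sum.cong) auto
    also have "\<dots> = \<beta> e" using that B by simp
    finally show ?thesis
      using \<beta> zero by (intro F_I[of "\<beta> e" 1 "\<lambda>e'. if e' = e then 1 else 0"])
        (simp_all add: spanned_def indets_one indets_zero)
  qed
  have F_add: "f + g \<in> F" if fg: "f \<in> F" "g \<in> F" for f g
  proof -
    obtain c d c' d' where c: "indets c \<subseteq> S" "c \<noteq> 0" "\<forall>e. indets (d e) \<subseteq> S"
        "c * f - (\<Sum>e\<in>B. d e * \<beta> e) \<in> Q"
      and c': "indets c' \<subseteq> S" "c' \<noteq> 0" "\<forall>e. indets (d' e) \<subseteq> S"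
        "c' * g - (\<Sum>e\<in>B. d' e * \<beta> e) \<in> Q"
      using fg unfolding F_def spanned_def by blast
    have "c' * (c * f - (\<Sum>e\<in>B. d e * \<beta> e)) + c * (c' * g - (\<Sum>e\<in>B. d' e * \<beta> e)) \<in> Q"
      using c c' SV by (intro add mult) auto
    also have "c' * (c * f - (\<Sum>e\<in>B. d e * \<beta> e)) + c * (c' * g - (\<Sum>e\<in>B. d' e * \<beta> e))
        = c * c' * (f + g) - (\<Sum>e\<in>B. (c' * d e + c * d' e) * \<beta> e)"
      by (simp add: algebra_simps sum.distrib sum_distrib_left)
    finally have "c * c' * (f + g) - (\<Sum>e\<in>B. (c' * d e + c * d' e) * \<beta> e) \<in> Q" .
    moreover have "indets (c * c') \<subseteq> S" "\<forall>e. indets (c' * d e + c * d' e) \<subseteq> S"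
      using c c' by (simp_all add: polys_mult polys_add)
    moreover have "indets (f + g) \<subseteq> V" using fg by (simp add: F_def polys_add)
    ultimately have "spanned (f + g) (c * c') (\<lambda>e. c' * d e + c * d' e)"
      using mpoly_mult_nonzero[OF c(2) c'(2)] by (simp add: spanned_def)
    with \<open>indets (f + g) \<subseteq> V\<close> show ?thesis by (rule F_I)
  qed
  have F_scale: "s * f \<in> F" if s: "indets s \<subseteq> S" and f: "f \<in> F" for s f
  proof -
    obtain c d where c: "indets c \<subseteq> S" "c \<noteq> 0" "\<forall>e. indets (d e) \<subseteq> S"
        "c * f - (\<Sum>e\<in>B. d e * \<beta> e) \<in> Q"
      using f unfolding F_def spanned_def by blast
    have "s * (c * f - (\<Sum>e\<in>B. d e * \<beta> e)) \<in> Q"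
      using c s SV by (intro mult) auto
    then have "c * (s * f) - (\<Sum>e\<in>B. (s * d e) * \<beta> e) \<in> Q"
      by (simp add: algebra_simps sum_distrib_left)
    moreover have "\<forall>e. indets (s * d e) \<subseteq> S" "indets (s * f) \<subseteq> V"
      using c s SV f by (simp_all add: F_def polys_mult)
    ultimately show ?thesis
      using c by (intro F_I[of "s * f" c "\<lambda>e. s * d e"]) (simp_all add: spanned_def)
  qed
  \<comment> \<open>A further factor \<open>s\<close> is absorbed into the denominator, which stays
    nonzero because \<open>K[S]\<close> has no zero divisors.\<close>
  have F_cancel: "f \<in> F" if asm: "indets s \<subseteq> S" "s \<noteq> 0" "s * f \<in> F" "indets f \<subseteq> V" for s f
  proof -
    obtain c d where c: "indets c \<subseteq> S" "c \<noteq> 0" "\<forall>e. indets (d e) \<subseteq> S"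
        "c * (s * f) - (\<Sum>e\<in>B. d e * \<beta> e) \<in> Q"
      using asm(3) unfolding F_def spanned_def by blast
    moreover have "indets (c * s) \<subseteq> S" "c * s \<noteq> 0"
      using c asm by (simp_all add: polys_mult mpoly_mult_eq_0_iff)
    ultimately show ?thesis
      using asm by (intro F_I[of f "c * s" d]) (simp_all add: spanned_def mult.assoc)
  qed
  have F_sum: "sum g A \<in> F" if "\<And>i. i \<in> A \<Longrightarrow> g i \<in> F" for g :: "'i \<Rightarrow> _" and A
    using that by (induction A rule: infinite_finite_induct) (auto intro: F_add F_Q zero)
  \<comment> \<open>Multiplying by \<open>v\<close> leaves the spanning set only when the exponent
    of \<open>v\<close> reaches \<open>n v\<close>. The relation for \<open>v\<close> then lowers
    it, and the factor \<open>c v\<close> is cancelled by \<open>F_cancel\<close>.\<close>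
  have F_var_\<beta>: "Var v * \<beta> e \<in> F" if v: "v \<in> V - S" and e: "e \<in> B" for v e
  proof -
    define \<gamma> where "\<gamma> = (\<Prod>u\<in>V - S - {v}. Var u ^ e u :: ('v, 'k) mpoly)"
    have \<gamma>: "indets \<gamma> \<subseteq> V" unfolding \<gamma>_def by (intro polys_prod polys_power) auto
    have upd: "\<beta> (e(v := i)) = Var v ^ i * \<gamma>" for i
      unfolding \<beta>_def using v assms(1) by (subst prod.remove[of _ v]) (auto simp: \<gamma>_def intro!: prod.cong)
    have upd_B: "e(v := i) \<in> B" if "i < n v" for i
      using e v that by (auto simp: B_def PiE_iff extensional_def)
    have *: "Var v * \<beta> e = Var v ^ Suc (e v) * \<gamma>" using upd[of "e v"] by (simp add: mult_ac)
    show ?thesis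
    proof (cases "Suc (e v) < n v")
      case True
      then show ?thesis using F_\<beta>[OF upd_B[OF True]] by (simp add: * upd)
    next
      case False
      then have n: "Suc (e v) = n v" using e v by (metis B_def PiE_mem Suc_lessI lessThan_iff)
      have "\<gamma> * (c v * Var v ^ n v - (\<Sum>i<n v. d v i * Var v ^ i)) + (\<Sum>i<n v. d v i * \<beta> (e(v := i))) \<in> F"
        using d[OF v] \<gamma> by (intro F_add F_Q[OF mult[OF rel[OF v]]] F_sum F_scale F_\<beta> upd_B) auto
      also have "\<gamma> * (c v * Var v ^ n v - (\<Sum>i<n v. d v i * Var v ^ i)) + (\<Sum>i<n v. d v i * \<beta> (e(v := i)))
          = c v * (Var v * \<beta> e)"
        unfolding * n upd by (simp add: algebra_simps sum_distrib_left)
      finally have "c v * (Var v * \<beta> e) \<in> F" .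
      then show ?thesis
        by (rule F_cancel[OF c(1)[OF v] c(2)[OF v]]) (use v in \<open>simp add: polys_mult \<beta>\<close>)
    qed
  qed
  have F_var: "Var v * f \<in> F" if v: "v \<in> V" and f: "f \<in> F" for v f
  proof (cases "v \<in> S")
    case True
    then show ?thesis using f by (intro F_scale) auto
  next
    case False
    obtain c d where c: "indets c \<subseteq> S" "c \<noteq> 0" "\<forall>e. indets (d e) \<subseteq> S"
        "c * f - (\<Sum>e\<in>B. d e * \<beta> e) \<in> Q"
      using f unfolding F_def spanned_def by blast
    have "Var v * (c * f - (\<Sum>e\<in>B. d e * \<beta> e)) + (\<Sum>e\<in>B. d e * (Var v * \<beta> e)) \<in> F"
      using v c False by (intro F_add F_Q[OF mult] F_sum F_scale F_var_\<beta>) auto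
    also have "Var v * (c * f - (\<Sum>e\<in>B. d e * \<beta> e)) + (\<Sum>e\<in>B. d e * (Var v * \<beta> e)) = c * (Var v * f)"
      by (simp add: algebra_simps sum_distrib_left)
    finally have "c * (Var v * f) \<in> F" .
    then show ?thesis
      by (rule F_cancel[OF c(1,2)]) (use v f in \<open>simp add: F_def polys_mult\<close>)
  qed
  have F_one: "1 \<in> F"
  proof -
    \<comment> \<open>The zero exponent vector, restricted to \<open>V - S\<close> for
      extensionality. It belongs to \<open>B\<close> because every \<open>n v\<close> is
      positive.\<close>
    define e where "e = (\<lambda>v\<in>V - S. 0::nat)"
    have "e \<in> B" using c by (auto simp: e_def B_def)
    moreover have "\<beta> e = 1" by (simp add: \<beta>_def e_def)
    ultimately show ?thesis using F_\<beta> by metis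
  qed
  have "f \<in> F" if "indets f \<subseteq> V" for f
    using that
  proof (induction f rule: polys_induct)
    case (const c)
    have "Poly_Mapping.single 0 c * 1 \<in> F"
      using F_one by (intro F_scale) (auto simp: indets_single)
    then show ?case by simp
  qed (use F_add F_var in auto)
  then show ?thesis
    using that[of B \<beta>] B unfolding F_def spanned_def by blast
qed

text \<open>The powers of \<open>f\<close> with exponents from 0 to \<open>card B\<close> are one
  more in number than the spanning elements, so up to denominators they are linearly dependent over
  \<open>K[S]\<close> modulo \<open>Q\<close>.\<close>

lemma algebraic_element:
  assumes "finite V" "S \<subseteq> V" and indep: "polys S \<inter> Q \<subseteq> {0}"
    and alg: "\<And>v. v \<in> V - S \<Longrightarrow> \<exists>p. p \<in> polys (insert v S) \<inter> Q \<and> p \<noteq> 0"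
    and f: "indets f \<subseteq> V" 
  shows "\<exists>a (n::nat). (\<forall>j\<le>n. indets (a j) \<subseteq> S) \<and> (\<exists>j\<le>n. a j \<noteq> 0) \<and> (\<Sum>j\<le>n. a j * f ^ j) \<in> Q"
proof -
  obtain B :: "('v \<Rightarrow> nat) set" and \<beta> :: "('v \<Rightarrow> nat) \<Rightarrow> ('v, 'k) mpoly" where B: "finite B"
    "\<And>f. indets f \<subseteq> V \<Longrightarrow> \<exists>c d. indets c \<subseteq> S \<and> c \<noteq> 0 \<and> (\<forall>e. indets (d e) \<subseteq> S)
       \<and> c * f - (\<Sum>e\<in>B. d e * \<beta> e) \<in> Q"
    using finite_span[OF assms(1-4)] by blast
  have SV: "indets p \<subseteq> V" if "indets p \<subseteq> S" for p :: "('v, 'k) mpoly"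
    using that assms(2) by blast
  define spanned where "spanned f c d \<longleftrightarrow> indets c \<subseteq> S \<and> c \<noteq> 0 \<and> (\<forall>e. indets (d e) \<subseteq> S)
      \<and> c * f - (\<Sum>e\<in>B. d e * \<beta> e) \<in> Q" for f c d
  have "\<exists>c d. spanned (f ^ j) c d" for j :: nat
    unfolding spanned_def by (intro B(2) polys_power f)
  then obtain c d where "spanned (f ^ j) (c j) (d j)" for j :: nat by metis
  then have c: "\<And>j. indets (c j) \<subseteq> S" "\<And>j. c j \<noteq> 0" "\<And>j e. indets (d j e) \<subseteq> S"
    and rel: "\<And>j::nat. c j * f ^ j - (\<Sum>e\<in>B. d j e * \<beta> e) \<in> Q"
    unfolding spanned_def by auto
  define n where "n = card B"
  \<comment> \<open>The powers of \<open>f\<close> index the unknowns and the spanning monomials the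
    equations; \<open>{..n}\<close> has \<open>card B + 1\<close> elements.\<close>
  have "\<exists>a. (\<forall>j\<in>{..n}. a j \<in> polys S) \<and> (\<exists>j\<in>{..n}. a j \<noteq> 0) \<and> (\<forall>e\<in>B. (\<Sum>j\<in>{..n}. a j * d j e) = 0)"
    using B(1) c by (intro exists_linear_dependence)
      (simp_all add: n_def indets_one polys_diff polys_mult mpoly_mult_eq_0_iff)
  then obtain a where a: "\<And>j. j \<le> n \<Longrightarrow> indets (a j) \<subseteq> S" "\<exists>j\<le>n. a j \<noteq> 0"
    "\<And>e. e \<in> B \<Longrightarrow> (\<Sum>j\<le>n. a j * d j e) = 0" by auto
  have "(\<Sum>j\<le>n. a j * (c j * f ^ j - (\<Sum>e\<in>B. d j e * \<beta> e))) \<in> Q"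
    using a SV by (intro sum mult rel) auto
  also have "(\<Sum>j\<le>n. a j * (c j * f ^ j - (\<Sum>e\<in>B. d j e * \<beta> e)))
      = (\<Sum>j\<le>n. a j * c j * f ^ j) - (\<Sum>j\<le>n. \<Sum>e\<in>B. a j * d j e * \<beta> e)"
    by (simp add: algebra_simps sum_subtractf sum_distrib_left)
  also have "(\<Sum>j\<le>n. \<Sum>e\<in>B. a j * d j e * \<beta> e) = (\<Sum>e\<in>B. (\<Sum>j\<le>n. a j * d j e) * \<beta> e)"
    by (subst sum.swap) (simp add: sum_distrib_right)
  also have "\<dots> = 0" using a(3) by simp
  finally have "(\<Sum>j\<le>n. a j * c j * f ^ j) \<in> Q" by simp
  \<comment> \<open>The denominators \<open>c j\<close> are absorbed into the coefficients; being
    nonzero, they preserve that some coefficient is nonzero.\<close>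
  then show ?thesis
    using a c by (intro exI[of _ "\<lambda>j. a j * c j"] exI[of _ n]) (simp add: polys_mult mpoly_mult_eq_0_iff)
qed

end

text \<open>The transcendence degree of the residue ring drops along a strict inclusion of primes;
  here this is read off from algebraically independent sets of variables.\<close>

lemma independent_vars_extend:
  fixes P Q :: "('v, 'k :: field) mpoly set"
  assumes "primeideal Q (poly_ring V)" "primeideal P (poly_ring V)" "Q \<subset> P"
    and "finite V" "S \<subseteq> V" and indep: "polys S \<inter> P \<subseteq> {0}"
  shows "\<exists>v\<in>V - S. polys (insert v S) \<inter> Q \<subseteq> {0}"
proof (rule ccontr)
  interpret Q: poly_prime V Q using assms(1) by (rule poly_prime.intro)
  interpret P: poly_prime V P using assms(2) by (rule poly_prime.intro)
  assume "\<not> ?thesis"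
  then have alg: "\<exists>p. p \<in> polys (insert v S) \<inter> Q \<and> p \<noteq> 0" if "v \<in> V - S" for v
    using that by blast
  obtain f where f: "f \<in> P" "f \<notin> Q" using assms(3) by blast
  obtain a n where a: "\<And>j. j \<le> n \<Longrightarrow> indets (a j) \<subseteq> S" "\<exists>j\<le>n. a j \<noteq> 0" "(\<Sum>j\<le>n::nat. a j * f ^ j) \<in> Q"
    using Q.algebraic_element[OF assms(4,5) _ alg P.sub[OF f(1)]] indep assms(3) by blast
  define k where "k = (LEAST j. j \<le> n \<and> a j \<noteq> 0)"
  have k: "k \<le> n" "a k \<noteq> 0" using a(2) LeastI_ex[of "\<lambda>j. j \<le> n \<and> a j \<noteq> 0"] by (auto simp: k_def)
  have low: "a j = 0" if "j < k" for j
    using that k not_less_Least[of j "\<lambda>j. j \<le> n \<and> a j \<noteq> 0"] by (auto simp: k_def[symmetric])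
  \<comment> \<open>The terms above index \<open>k\<close>, divided by
    \<open>f ^ Suc k\<close>.\<close>
  define g where "g = (\<Sum>j\<in>{Suc k..n}. a j * f ^ (j - Suc k))"
  have fV: "indets f \<subseteq> V" and aV: "\<And>j. j \<le> n \<Longrightarrow> indets (a j) \<subseteq> V"
    using P.sub[OF f(1)] a(1) assms(5) by blast+
  then have gV: "indets g \<subseteq> V"
    unfolding g_def by (intro polys_sum polys_mult polys_power) auto
  have "(\<Sum>j\<le>n. a j * f ^ j) = (\<Sum>j\<in>insert k {Suc k..n}. a j * f ^ j)"
  proof (intro sum.mono_neutral_right ballI)
    fix i assume "i \<in> {..n} - insert k {Suc k..n}"
    then have "i < k" by auto
    then show "a i * f ^ i = 0" by (simp add: low)
  qed (use k in auto)
  also have "\<dots> = a k * f ^ k + (\<Sum>j\<in>{Suc k..n}. a j * f ^ j)"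
    by simp
  also have "(\<Sum>j\<in>{Suc k..n}. a j * f ^ j) = f ^ k * (f * g)"
    unfolding g_def sum_distrib_left
  proof (intro sum.cong refl)
    fix j assume "j \<in> {Suc k..n}"
    then have "f ^ j = f ^ k * (f * f ^ (j - Suc k))"
      by (metis atLeastAtMost_iff le_add_diff_inverse power_Suc power_add add_Suc_shift)
    then show "a j * f ^ j = f ^ k * (f * (a j * f ^ (j - Suc k)))" by (simp add: mult_ac)
  qed
  \<comment> \<open>Since \<open>f\<close> is not in the prime \<open>Q\<close>, the factor
    \<open>f ^ k\<close> can be cancelled. As \<open>f\<close> is in \<open>P\<close>, so is
    \<open>a k\<close>, which then vanishes by the independence of \<open>S\<close>.\<close>
  finally have "f ^ k * (a k + g * f) \<in> Q"
    using a(3) by (simp add: algebra_simps)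
  moreover have "indets (a k + g * f) \<subseteq> V" "indets (f ^ k) \<subseteq> V"
    using fV gV aV k by (simp_all add: polys_add polys_mult polys_power)
  ultimately have "a k + g * f \<in> Q"
    using Q.primeD Q.powerD f fV by blast
  then have "(a k + g * f) - g * f \<in> P"
    using assms(3) f gV by (intro P.diff P.mult) auto
  then have "a k = 0" using indep a(1) k by auto
  then show False using k by simp
qed

section \<open>Height of a prime generated by variables\<close>

text \<open>Going down a chain of primes, an independent set of variables gains one element per step
  and stays inside \<open>V\<close>, which bounds the length. Conversely, adjoining the variables of
  \<open>C\<close> one by one to the zero ideal gives a chain of length
  \<open>card C\<close>.\<close>

lemma prime_height_var_ideal:
  assumes "finite V" "C \<subseteq> V"
  shows "prime_height (poly_ring V) (var_ideal V C :: ('v, 'k :: field) mpoly set) = enat (card C)"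
  unfolding prime_height_def
proof (intro antisym Sup_least Sup_upper)
  let ?P = "var_ideal V C :: ('v, 'k) mpoly set"
  have C: "finite C" using assms finite_subset by blast
  fix h assume "h \<in> {enat k | k. \<exists>Q. (\<forall>i\<le>k. primeideal (Q i) (poly_ring V)) \<and>
      (\<forall>i<k. Q i \<subset> Q (Suc i)) \<and> Q k = ?P}"
  then obtain k Q where h: "h = enat k" and Q: "\<And>i. i \<le> k \<Longrightarrow> primeideal (Q i) (poly_ring V)"
      "\<And>i. i < k \<Longrightarrow> Q i \<subset> Q (Suc i)" "Q k = ?P"
    by blast
  \<comment> \<open>Here \<open>j\<close> counts steps down from the top of the chain, so
    \<open>j = k\<close> belongs to the smallest prime \<open>Q 0\<close>.\<close>
  have "\<exists>S\<subseteq>V. card S = card (V - C) + j \<and> polys S \<inter> Q (k - j) \<subseteq> {0}" if "j \<le> k" for j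
    using that
  proof (induction j)
    case 0
    have "p = 0" if "indets p \<subseteq> V - C" "p \<in> ?P" for p
      using that by (force simp: var_ideal_def indets_def simp flip: keys_eq_empty)
    then show ?case by (intro exI[of _ "V - C"]) (auto simp: Q(3))
  next
    case (Suc j)
    then obtain S where S: "S \<subseteq> V" "card S = card (V - C) + j" "polys S \<inter> Q (k - j) \<subseteq> {0}"
      by auto
    have "Suc (k - Suc j) = k - j" using Suc by simp
    then have "Q (k - Suc j) \<subset> Q (k - j)" using Q(2)[of "k - Suc j"] Suc.prems by simp
    then obtain v where "v \<in> V - S" "polys (insert v S) \<inter> Q (k - Suc j) \<subseteq> {0}"
      using independent_vars_extend[OF Q(1) Q(1) _ assms(1) S(1,3)] by (meson diff_le_self)
    moreover from this have "card (insert v S) = card (V - C) + Suc j"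
      using S assms(1) finite_subset by (subst card_insert_disjoint) auto
    ultimately show ?case using S by (intro exI[of _ "insert v S"]) auto
  qed
  from this[of k] obtain S where "S \<subseteq> V" "card S = card (V - C) + k" by auto
  then have "card (V - C) + k \<le> card V" using card_mono[OF assms(1)] by metis
  then show "h \<le> enat (card C)"
    using assms C by (simp add: h card_Diff_subset)
next
  have C: "finite C" using assms finite_subset by blast
  obtain xs where xs: "set xs = C" "distinct xs" using finite_distinct_list[OF C] by blast
  \<comment> \<open>The step from \<open>i\<close> to \<open>Suc i\<close> adjoins the variable
    \<open>xs ! i\<close>, which witnesses that the inclusion is strict.\<close>
  define Q where "Q i = (var_ideal V (set (take i xs)) :: ('v, 'k) mpoly set)" for i
  have "Q i \<subset> Q (Suc i)" if i: "i < card C" for i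
  proof -
    have len: "i < length xs" using i xs distinct_card by fastforce
    have "Q i \<subseteq> Q (Suc i)"
      using set_take_subset_set_take[of i "Suc i" xs] by (force simp: Q_def var_ideal_def)
    moreover have "xs ! i \<notin> set (take i xs)"
      using xs len by (auto simp: in_set_conv_nth nth_eq_iff_index_eq)
    then have "Var (xs ! i) \<notin> Q i"
      by (simp add: Q_def var_ideal_def Var_def)
    moreover have "Var (xs ! i) \<in> Q (Suc i)"
      using xs len assms(2) by (auto simp: Q_def var_ideal_def take_Suc_conv_app_nth Var_def indets_single)
    ultimately show ?thesis by blast
  qed
  moreover have "Q (card C) = var_ideal V C"
    using xs by (simp add: Q_def distinct_card[symmetric])
  moreover have "primeideal (Q i) (poly_ring V)" for i
    unfolding Q_def by (rule primeideal_var_ideal)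
  ultimately show "enat (card C) \<in> {enat k | k. \<exists>Q :: nat \<Rightarrow> ('v, 'k) mpoly set.
      (\<forall>i\<le>k. primeideal (Q i) (poly_ring V)) \<and> (\<forall>i<k. Q i \<subset> Q (Suc i)) \<and> Q k = var_ideal V C}"
    by blast
qed

section \<open>Associated primes of edge ideals\<close>

lemma independent_set_extends:
  assumes "finite (verts G)" "independent_set G S"
  obtains T where "maximal_independent_set G T" "S \<subseteq> T"
proof -
  have "finite {T. independent_set G T}"
    by (rule finite_subset[of _ "Pow (verts G)"]) (use assms(1) in \<open>auto simp: independent_set_def\<close>)
  from finite_has_maximal2[OF this, of S] assms(2) show ?thesis
    using that unfolding maximal_independent_set_def by blast
qed

lemma facets_independence_complex:
  "facets (independence_complex G) = {S. maximal_independent_set G S}"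
  by (auto simp: facets_def independence_complex_def maximal_independent_set_def)

lemma pure_iff_well_covered: "pure_complex (independence_complex G) \<longleftrightarrow> well_covered G"
  by (auto simp: pure_complex_def well_covered_def facets_independence_complex)

text \<open>For distinct \<open>x\<close> and \<open>y\<close>, a monomial is divisible by their
  product as soon as both occur in it, so membership can be read off from supports.\<close>

lemma edge_ideal_eq:
  assumes "finite_simple_graph G"
  shows "(edge_ideal G :: ('v, 'k :: field) mpoly set) =
    {p \<in> polys (verts G). \<forall>m\<in>Poly_Mapping.keys p. \<exists>e\<in>edges G. e \<subseteq> Poly_Mapping.keys m}"
    (is "_ = ?I")
proof
  interpret cring "poly_ring (verts G) :: ('v, 'k) mpoly ring" by (rule cring_poly_ring)
  let ?X = "{Var x * Var y | x y. {x, y} \<in> edges G} :: ('v, 'k) mpoly set"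
  have Var2: "Var x * Var y
      = (Poly_Mapping.single (Poly_Mapping.single x 1 + Poly_Mapping.single y 1) 1 :: ('v, 'k) mpoly)" for x y
    by (simp add: Var_def mult_single)
  have vertsD: "x \<in> verts G" "y \<in> verts G" if "{x, y} \<in> edges G" for x y
    using assms that by (auto simp: finite_simple_graph_def)
  have X_sub: "?X \<subseteq> carrier (poly_ring (verts G))"
    using vertsD by (auto simp: poly_ring_def Var2 indets_single keys_add_nat simp del: single_add)
  have "ideal ?I (poly_ring (verts G))"
    unfolding ideal_poly_ring_iff
  proof (intro conjI ballI)
    fix p q :: "('v, 'k) mpoly" assume "p \<in> ?I" "q \<in> ?I"
    then show "p + q \<in> ?I"
      using keys_add[of p q] by (auto simp: polys_add)
  next
    fix p r :: "('v, 'k) mpoly" assume p: "p \<in> ?I" and r: "r \<in> polys (verts G)"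
    have "\<exists>e\<in>edges G. e \<subseteq> Poly_Mapping.keys m" if m: "m \<in> Poly_Mapping.keys (r * p)" for m
    proof -
      obtain s t where "m = s + t" "t \<in> Poly_Mapping.keys p"
        using m keys_mult[of r p] by blast
      moreover from this obtain e where "e \<in> edges G" "e \<subseteq> Poly_Mapping.keys t"
        using p by blast
      ultimately show ?thesis by (auto simp: keys_add_nat)
    qed
    then show "r * p \<in> ?I" using p r by (simp add: polys_mult)
  qed (auto simp: indets_zero)
  moreover have "?X \<subseteq> ?I"
  proof
    fix q assume "q \<in> ?X"
    then obtain x y where q: "q = Var x * Var y" "{x, y} \<in> edges G" by blast
    show "q \<in> ?I"
      using vertsD[OF q(2)] q
      by (auto simp: Var2 indets_single keys_add_nat intro!: bexI[of _ "{x, y}"])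
  qed
  ultimately show "edge_ideal G \<subseteq> ?I"
    unfolding edge_ideal_def by (rule genideal_minimal)
  have J: "ideal (edge_ideal G :: ('v, 'k) mpoly set) (poly_ring (verts G))"
    unfolding edge_ideal_def by (rule genideal_ideal[OF X_sub])
  have X_J: "?X \<subseteq> edge_ideal G"
    unfolding edge_ideal_def by (rule genideal_self[OF X_sub])
  show "?I \<subseteq> edge_ideal G"
  proof
    fix p :: "('v, 'k) mpoly" assume p: "p \<in> ?I"
    have mono: "Poly_Mapping.single m c \<in> (edge_ideal G :: ('v, 'k) mpoly set)"
      if m: "m \<in> Poly_Mapping.keys p" for m c
    proof -
      obtain e where e: "e \<in> edges G" "e \<subseteq> Poly_Mapping.keys m" using p m by blast
      then obtain x y where xy: "e = {x, y}" "x \<noteq> y"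
        using assms by (auto simp: finite_simple_graph_def card_2_iff)
      \<comment> \<open>The cofactor of the edge monomial in \<open>m\<close>; the truncated
        subtraction is exact because \<open>x\<close> and \<open>y\<close> are distinct and both
        occur in \<open>m\<close>.\<close>
      define u where "u = m - (Poly_Mapping.single x 1 + Poly_Mapping.single y 1)"
      have mu: "m = u + (Poly_Mapping.single x 1 + Poly_Mapping.single y 1)"
        using e xy by (intro poly_mapping_eqI)
          (auto simp: u_def lookup_add lookup_minus lookup_single when_def in_keys_iff)
      have "Poly_Mapping.keys m \<subseteq> verts G" using p m by (auto simp: indets_def)
      then have "indets (Poly_Mapping.single u c) \<subseteq> verts G"
        using arg_cong[OF mu, of Poly_Mapping.keys] by (auto simp: indets_single keys_add_nat simp del: keys_single)
      moreover have "Var x * Var y \<in> (edge_ideal G :: ('v, 'k) mpoly set)" using X_J e xy by blast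
      ultimately have "Poly_Mapping.single u c * (Var x * Var y) \<in> edge_ideal G"
        using J unfolding ideal_poly_ring_iff by blast
      also have "Poly_Mapping.single u c * (Var x * Var y) = Poly_Mapping.single m c"
        unfolding Var2 mult_single mu[symmetric] by simp
      finally show ?thesis .
    qed
    have "(\<Sum>m\<in>A. Poly_Mapping.single m (Poly_Mapping.lookup p m)) \<in> edge_ideal G"
      if "A \<subseteq> Poly_Mapping.keys p" for A
      using finite_subset[OF that finite_keys] that
    proof (induction rule: finite_induct)
      case empty
      then show ?case using J unfolding ideal_poly_ring_iff by simp
    next
      case (insert m A)
      then show ?case using J mono unfolding ideal_poly_ring_iff by simp
    qed
    then show "p \<in> edge_ideal G"
      by (subst poly_mapping_sum_single) simp
  qed
qed

text \<open>Every edge meets the complement of an independent set. Conversely, a support containing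
  no edge is independent and extends to a maximal independent set \<open>S\<close>; the monomial is
  then not in the prime belonging to \<open>S\<close>.\<close>

lemma edge_ideal_eq_Inter:
  assumes "finite_simple_graph G"
  shows "(edge_ideal G :: ('v, 'k :: field) mpoly set) =
    {p \<in> polys (verts G). \<forall>S. maximal_independent_set G S \<longrightarrow> p \<in> var_ideal (verts G) (verts G - S)}"
    (is "_ = ?I")
proof (intro equalityI subsetI)
  fix p :: "('v, 'k) mpoly" assume p: "p \<in> edge_ideal G"
  have "p \<in> var_ideal (verts G) (verts G - S)" if S: "maximal_independent_set G S" for S
  proof -
    have "Poly_Mapping.keys m \<inter> (verts G - S) \<noteq> {}" if m: "m \<in> Poly_Mapping.keys p" for m
    proof -
      obtain e where e: "e \<in> edges G" "e \<subseteq> Poly_Mapping.keys m"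
        using m p unfolding edge_ideal_eq[OF assms] by blast
      moreover have "e \<subseteq> verts G" "\<not> e \<subseteq> S"
        using e S assms by (auto simp: maximal_independent_set_def independent_set_def finite_simple_graph_def)
      ultimately show ?thesis by blast
    qed
    then show ?thesis using p assms by (simp add: edge_ideal_eq var_ideal_def)
  qed
  then show "p \<in> ?I" using p assms by (simp add: edge_ideal_eq)
next
  fix p assume p: "p \<in> ?I"
  have "\<exists>e\<in>edges G. e \<subseteq> Poly_Mapping.keys m" if m: "m \<in> Poly_Mapping.keys p" for m
  proof (rule ccontr)
    assume "\<not> ?thesis"
    then have "independent_set G (Poly_Mapping.keys m)"
      using p m by (auto simp: independent_set_def indets_def)
    then obtain S where S: "maximal_independent_set G S" "Poly_Mapping.keys m \<subseteq> S"
      using independent_set_extends assms unfolding finite_simple_graph_def by metis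
    then have "p \<in> var_ideal (verts G) (verts G - S)" using p by blast
    then show False using m S(2) by (auto simp: var_ideal_def)
  qed
  then show "p \<in> edge_ideal G" using p assms by (simp add: edge_ideal_eq)
qed

text \<open>A colon ideal of an intersection of finitely many primes is again an intersection of
  some of them; if it is prime, it equals one of these. Conversely, the prime belonging to
  \<open>S\<close> is the colon ideal by the product of the variables in \<open>S\<close>.\<close>

lemma associated_primes_edge_ideal:
  assumes G: "finite_simple_graph G"
  shows "associated_primes (poly_ring (verts G)) (edge_ideal G :: ('v, 'k :: field) mpoly set) =
    {var_ideal (verts G) (verts G - S) | S. maximal_independent_set G S}"
proof (intro equalityI subsetI)
  let ?V = "verts G"
  let ?P = "\<lambda>S. var_ideal ?V (?V - S) :: ('v, 'k) mpoly set"
  let ?M = "{S. maximal_independent_set G S}"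
  have "finite ?M"
    by (rule finite_subset[of _ "Pow ?V"])
      (use G in \<open>auto simp: maximal_independent_set_def independent_set_def finite_simple_graph_def\<close>)
  fix P assume "P \<in> associated_primes (poly_ring ?V) (edge_ideal G :: ('v, 'k) mpoly set)"
  then obtain f where prime: "primeideal P (poly_ring ?V)" and f: "f \<in> polys ?V"
    and P: "P = {g \<in> polys ?V. g * f \<in> edge_ideal G}"
    by (auto simp: associated_primes_def poly_ring_def)
  interpret P: poly_prime ?V P by (rule poly_prime.intro) (rule prime)
  have var_prime: "poly_prime ?V (?P S)" for S
    by (rule poly_prime.intro) (rule primeideal_var_ideal)
  note var_mult = poly_prime.mult[OF var_prime] and var_primeD = poly_prime.primeD[OF var_prime]
  define M where "M = {S \<in> ?M. f \<notin> ?P S}"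
  \<comment> \<open>Primes containing \<open>f\<close> impose no condition on \<open>g * f\<close>;
    the others contain \<open>g * f\<close> only if they contain \<open>g\<close>.\<close>
  have P_eq: "P = {g \<in> polys ?V. \<forall>S\<in>M. g \<in> ?P S}"
  proof (intro equalityI subsetI)
    fix g assume g: "g \<in> P"
    have "g \<in> ?P S" if "S \<in> M" for S
      using var_primeD[of g f S] g f that by (simp add: M_def P edge_ideal_eq_Inter[OF G])
    then show "g \<in> {g \<in> polys ?V. \<forall>S\<in>M. g \<in> ?P S}" using g by (simp add: P)
  next
    fix g assume g: "g \<in> {g \<in> polys ?V. \<forall>S\<in>M. g \<in> ?P S}"
    have "g * f \<in> ?P S" if "S \<in> ?M" for S
    proof (cases "f \<in> ?P S")
      case True
      then show ?thesis using g by (intro var_mult) auto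
    next
      case False
      then have "f * g \<in> ?P S" using g f that by (intro var_mult) (auto simp: M_def)
      then show ?thesis by (simp add: mult.commute)
    qed
    then show "g \<in> P" using g f by (simp add: P edge_ideal_eq_Inter[OF G] polys_mult)
  qed
  \<comment> \<open>Otherwise each \<open>?P S\<close> with \<open>S\<close> in \<open>M\<close> has
    an element outside \<open>P\<close>. Their product lies in all of these ideals, hence in
    \<open>P\<close>, against primality. For empty \<open>M\<close> the product is 1, which is not
    in \<open>P\<close> either.\<close>
  have "\<exists>S\<in>M. P = ?P S"
  proof (rule ccontr)
    assume "\<not> ?thesis"
    then have "\<exists>g. g \<in> ?P S \<and> g \<notin> P" if "S \<in> M" for S
    proof -
      have "P \<subseteq> ?P S" using that P_eq by blast
      with that \<open>\<not> (\<exists>S\<in>M. P = ?P S)\<close> show ?thesis by blast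
    qed
    then obtain g where g: "\<And>S. S \<in> M \<Longrightarrow> g S \<in> ?P S" "\<And>S. S \<in> M \<Longrightarrow> g S \<notin> P" by metis
    have gV: "indets (g S) \<subseteq> ?V" if "S \<in> M" for S
      using g(1)[OF that] by (simp add: var_ideal_def)
    have M: "finite M" using \<open>finite ?M\<close> by (simp add: M_def)
    have "prod g M \<in> ?P S" if "S \<in> M" for S
    proof -
      have "indets (prod g (M - {S})) \<subseteq> ?V" using gV by (intro polys_prod) auto
      then have "prod g (M - {S}) * g S \<in> ?P S" using g(1)[OF that] by (intro var_mult)
      then show ?thesis by (simp add: prod.remove[OF M that] mult.commute)
    qed
    moreover have "indets (prod g M) \<subseteq> ?V" using gV by (rule polys_prod)
    ultimately have "prod g M \<in> P" by (simp add: P_eq)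
    moreover have "prod g A \<notin> P" if "finite A" "A \<subseteq> M" for A
      using that
    proof (induction rule: finite_induct)
      case empty
      then show ?case using P.one by simp
    next
      case (insert S A)
      moreover have "indets (prod g A) \<subseteq> ?V"
        by (rule polys_prod) (use insert gV in auto)
      ultimately show ?case using P.primeD[of "g S" "prod g A"] g(2)[of S] gV[of S] by auto
    qed
    ultimately show False using M by blast
  qed
  then show "P \<in> {?P S | S. maximal_independent_set G S}" by (auto simp: M_def)
next
  let ?V = "verts G"
  fix P :: "('v, 'k) mpoly set"
  assume "P \<in> {var_ideal ?V (?V - S) | S. maximal_independent_set G S}"
  then obtain S where P: "P = var_ideal ?V (?V - S)" and S: "maximal_independent_set G S" by blast
  interpret P: poly_prime ?V P unfolding P by (rule poly_prime.intro) (rule primeideal_var_ideal)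
  have SV: "S \<subseteq> ?V" using S by (simp add: maximal_independent_set_def independent_set_def)
  then have "finite S" by (rule finite_subset) (use G in \<open>simp add: finite_simple_graph_def\<close>)
  \<comment> \<open>The squarefree monomial with support \<open>S\<close>. It is not in
    \<open>P\<close>, but multiplying it by any variable outside \<open>S\<close> completes an edge,
    by maximality.\<close>
  define m where "m = (\<Sum>v\<in>S. Poly_Mapping.single v (1::nat))"
  have keys_m: "Poly_Mapping.keys m = S"
    unfolding set_eq_iff
  proof
    fix u
    have "Poly_Mapping.lookup m u = (\<Sum>v\<in>S. if v = u then 1 else 0)"
      unfolding m_def lookup_sum by (intro sum.cong) (auto simp: lookup_single when_def)
    also have "\<dots> = (if u \<in> S then 1 else 0)" using \<open>finite S\<close> by simp
    finally show "u \<in> Poly_Mapping.keys m \<longleftrightarrow> u \<in> S" by (simp add: in_keys_iff)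
  qed
  define f where "f = (Poly_Mapping.single m 1 :: ('v, 'k) mpoly)"
  have f: "indets f \<subseteq> ?V" using SV by (simp add: f_def indets_single keys_m)
  have "f \<notin> P" by (simp add: P var_ideal_def f_def keys_m)
  have "g * f \<in> edge_ideal G" if g: "g \<in> P" for g
  proof -
    have "\<exists>e\<in>edges G. e \<subseteq> Poly_Mapping.keys t" if t: "t \<in> Poly_Mapping.keys (g * f)" for t
    proof -
      obtain s where s: "s \<in> Poly_Mapping.keys g" "t = s + m"
        using t keys_mult[of g f] by (auto simp: f_def)
      then obtain x where x: "x \<in> Poly_Mapping.keys s" "x \<in> ?V" "x \<notin> S"
        using g by (auto simp: P var_ideal_def)
      have "\<not> independent_set G (insert x S)"
        using S x by (auto simp: maximal_independent_set_def)
      then obtain e where "e \<in> edges G" "e \<subseteq> insert x S"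
        using x SV by (auto simp: independent_set_def)
      then show ?thesis using x s by (intro bexI[of _ e]) (auto simp: keys_add_nat keys_m)
    qed
    then show ?thesis
      using P.sub[OF g] f by (simp add: edge_ideal_eq[OF G] polys_mult)
  qed
  moreover have "g \<in> P" if "indets g \<subseteq> ?V" "g * f \<in> edge_ideal G" for g
  proof -
    have "g * f \<in> P" using that S by (simp add: edge_ideal_eq_Inter[OF G] P)
    then show ?thesis using P.primeD[of g f] that f \<open>f \<notin> P\<close> by blast
  qed
  ultimately have "P = {g \<in> polys ?V. g * f \<in> edge_ideal G}" using P.sub by blast
  then show "P \<in> associated_primes (poly_ring ?V) (edge_ideal G)"
    using P.prime f by (auto simp: associated_primes_def poly_ring_def)
qed

text \<open>The prime belonging to \<open>S\<close> is generated by the variables outside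
  \<open>S\<close>, so equal heights mean equal cardinalities of the maximal independent
  sets.\<close>

lemma unmixed_edge_ideal_iff:
  assumes G: "finite_simple_graph G"
  shows "unmixed (poly_ring (verts G)) (edge_ideal G :: ('v, 'k :: field) mpoly set) \<longleftrightarrow> well_covered G"
proof -
  have fin: "finite (verts G)" using G by (simp add: finite_simple_graph_def)
  have height: "prime_height (poly_ring (verts G)) (var_ideal (verts G) (verts G - S) :: ('v, 'k) mpoly set)
      = enat (card (verts G) - card S)" and le: "card S \<le> card (verts G)"
    if "maximal_independent_set G S" for S
  proof -
    have S: "S \<subseteq> verts G"
      using that by (simp add: maximal_independent_set_def independent_set_def)
    then show "card S \<le> card (verts G)" using fin by (rule card_mono[rotated])
    show "prime_height (poly_ring (verts G)) (var_ideal (verts G) (verts G - S) :: ('v, 'k) mpoly set)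
      = enat (card (verts G) - card S)"
      using S fin by (simp add: prime_height_var_ideal card_Diff_subset finite_subset)
  qed
  let ?h = "\<lambda>S. prime_height (poly_ring (verts G)) (var_ideal (verts G) (verts G - S) :: ('v, 'k) mpoly set)"
  \<comment> \<open>Neither cardinality exceeds \<open>card (verts G)\<close>, so the truncated
    differences determine them.\<close>
  have height_eq_iff: "?h S = ?h T \<longleftrightarrow> card S = card T"
    if "maximal_independent_set G S" "maximal_independent_set G T" for S T
    using le[OF that(1)] le[OF that(2)] by (auto simp: height that)
  have "unmixed (poly_ring (verts G)) (edge_ideal G :: ('v, 'k) mpoly set) \<longleftrightarrow>
    (\<forall>S T. maximal_independent_set G S \<longrightarrow> maximal_independent_set G T \<longrightarrow> ?h S = ?h T)"
    unfolding unmixed_def associated_primes_edge_ideal[OF G] by blast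
  then show ?thesis
    unfolding well_covered_def using height_eq_iff by blast
qed

section \<open>Joins and disjoint unions\<close>

lemma maximal_independent_set_edgeless:
  "maximal_independent_set (edgeless_graph a) S \<longleftrightarrow> S = {1..a}"
proof -
  have "independent_set (edgeless_graph a) T \<longleftrightarrow> T \<subseteq> {1..a}" for T
    by (simp add: independent_set_def edgeless_graph_def)
  then show ?thesis
    unfolding maximal_independent_set_def by blast
qed

text \<open>Each left vertex is adjacent to each right vertex, so an independent set stays on one
  side. The empty set belongs to both alternatives.\<close>

lemma independent_set_join:
  assumes "finite_simple_graph G" "finite_simple_graph H"
  shows "independent_set (graph_join G H) T \<longleftrightarrow>
    (\<exists>S. independent_set G S \<and> T = Inl ` S) \<or> (\<exists>S. independent_set H S \<and> T = Inr ` S)"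
    (is "?L \<longleftrightarrow> ?R")
proof
  assume T: ?L
  have "\<not> (Inl u \<in> T \<and> Inr v \<in> T)" for u v
  proof
    assume uv: "Inl u \<in> T \<and> Inr v \<in> T"
    then have "u \<in> verts G" "v \<in> verts H"
      using T by (auto simp: independent_set_def graph_join_def)
    then have "{Inl u, Inr v} \<in> edges (graph_join G H)"
      unfolding graph_join_def by simp blast
    then show False using T uv by (auto simp: independent_set_def)
  qed
  then have "T \<subseteq> range Inl \<or> T \<subseteq> range Inr"
    by (metis rangeI subsetI sum.exhaust)
  then consider "T = Inl ` (Inl -` T)" | "T = Inr ` (Inr -` T)"
    by (auto simp: image_vimage_eq inf.absorb1)
  then show ?R
  proof cases
    case 1
    have "independent_set G (Inl -` T)"
      unfolding independent_set_def
    proof (intro conjI ballI notI)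
      fix e assume "e \<in> edges G" "e \<subseteq> Inl -` T"
      then have "Inl ` e \<in> edges (graph_join G H)" "Inl ` e \<subseteq> T" by (auto simp: graph_join_def)
      then show False using T by (auto simp: independent_set_def)
    qed (use T in \<open>auto simp: independent_set_def graph_join_def\<close>)
    with 1 show ?thesis by blast
  next
    case 2
    have "independent_set H (Inr -` T)"
      unfolding independent_set_def
    proof (intro conjI ballI notI)
      fix e assume "e \<in> edges H" "e \<subseteq> Inr -` T"
      then have "Inr ` e \<in> edges (graph_join G H)" "Inr ` e \<subseteq> T" by (auto simp: graph_join_def)
      then show False using T by (auto simp: independent_set_def)
    qed (use T in \<open>auto simp: independent_set_def graph_join_def\<close>)
    with 2 show ?thesis by blast
  qed
next
  \<comment> \<open>Edges are nonempty, so an edge of one side is never contained in a set of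
    vertices of the other side.\<close>
  have "e \<noteq> {}" if "e \<in> edges G \<or> e \<in> edges H'" "finite_simple_graph G" "finite_simple_graph H'"
    for e :: "'c set" and G H' :: "'c sgraph"
    using that by (auto simp: finite_simple_graph_def)
  then have "{} \<notin> edges G" "{} \<notin> edges H" using assms by blast+
  moreover have "\<not> Inr ` e \<subseteq> Inl ` S" if "e \<noteq> {}" for e :: "'b set" and S :: "'a set"
    using that by auto
  moreover have "\<not> Inl ` e \<subseteq> Inr ` S" if "e \<noteq> {}" for e :: "'a set" and S :: "'b set"
    using that by auto
  moreover assume ?R
  ultimately show ?L
    by (auto simp: independent_set_def graph_join_def inj_image_subset_iff simp del: image_subset_iff) metis+
qed

lemma maximal_independent_set_joinE:
  assumes "finite_simple_graph G" "finite_simple_graph H"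
    and T: "maximal_independent_set (graph_join G H) T"
  obtains S where "maximal_independent_set G S" "T = Inl ` S"
    | S where "maximal_independent_set H S" "T = Inr ` S"
proof -
  note indep = independent_set_join[OF assms(1,2)]
  have "independent_set (graph_join G H) T"
    and max: "\<And>T'. independent_set (graph_join G H) T' \<Longrightarrow> T \<subseteq> T' \<Longrightarrow> T' = T"
    using T by (auto simp: maximal_independent_set_def)
  then consider S where "independent_set G S" "T = Inl ` S" | S where "independent_set H S" "T = Inr ` S"
    unfolding indep by blast
  then show ?thesis
  proof cases
    case (1 S)
    have "S' = S" if "independent_set G S'" "S \<subseteq> S'" for S'
      using max[of "Inl ` S'"] that 1(2) unfolding indep by (auto simp: inj_image_eq_iff)
    then show ?thesis using 1 that(1)[of S] by (auto simp: maximal_independent_set_def)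
  next
    case (2 S)
    have "S' = S" if "independent_set H S'" "S \<subseteq> S'" for S'
      using max[of "Inr ` S'"] that 2(2) unfolding indep by (auto simp: inj_image_eq_iff)
    then show ?thesis using 2 that(2)[of S] by (auto simp: maximal_independent_set_def)
  qed
qed

text \<open>A strictly larger independent set in the \<open>k\<close>-th copy could be added to
  \<open>U\<close>, since no edge joins different copies.\<close>

lemma maximal_independent_set_copies_section:
  assumes U: "maximal_independent_set (copies n G) U" and k: "k \<in> {1..n}"
  shows "maximal_independent_set G (Pair k -` U)"
  unfolding maximal_independent_set_def
proof (intro conjI allI impI)
  have indep: "independent_set (copies n G) U" using U by (simp add: maximal_independent_set_def)
  show "independent_set G (Pair k -` U)"
    unfolding independent_set_def
  proof (intro conjI ballI notI)
    fix e assume "e \<in> edges G" "e \<subseteq> Pair k -` U"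
    then have "Pair k ` e \<in> edges (copies n G)" "Pair k ` e \<subseteq> U" using k by (auto simp: copies_def)
    then show False using indep by (auto simp: independent_set_def)
  qed (use indep in \<open>auto simp: independent_set_def copies_def\<close>)
  fix S assume S: "independent_set G S \<and> Pair k -` U \<subseteq> S"
  have "independent_set (copies n G) (U \<union> Pair k ` S)"
    unfolding independent_set_def
  proof (intro conjI ballI notI)
    show "U \<union> Pair k ` S \<subseteq> verts (copies n G)"
      using indep S k by (auto simp: independent_set_def copies_def)
    fix e assume "e \<in> edges (copies n G)" and e: "e \<subseteq> U \<union> Pair k ` S"
    then obtain j d where j: "e = Pair j ` d" "j \<in> {1..n}" "d \<in> edges G" by (auto simp: copies_def)
    show False
    proof (cases "j = k")
      case True
      then have "d \<subseteq> S" using e S j by auto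
      then show ?thesis using j S by (auto simp: independent_set_def)
    next
      case False
      then have "e \<subseteq> U" using e j by auto
      then show ?thesis using \<open>e \<in> edges (copies n G)\<close> indep by (auto simp: independent_set_def)
    qed
  qed
  then have "U \<union> Pair k ` S = U" using U by (auto simp: maximal_independent_set_def)
  then show "S = Pair k -` U" using S by auto
qed

text \<open>\<open>U\<close> is the disjoint union of its sections over the \<open>n\<close> copies,
  and each section is maximal independent in \<open>G\<close>.\<close>

lemma card_maximal_independent_set_copies:
  assumes "finite (verts G)" and U: "maximal_independent_set (copies n G) U"
    and c: "\<And>S. maximal_independent_set G S \<Longrightarrow> card S = c"
  shows "card U = n * c"
proof -
  have U_sub: "U \<subseteq> {1..n} \<times> verts G"
    using U by (auto simp: maximal_independent_set_def independent_set_def copies_def)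
  then have U_eq: "U = (SIGMA k:{1..n}. Pair k -` U)" by auto
  have "finite (Pair k -` U)" for k
    using U_sub by (intro finite_subset[OF _ assms(1)]) auto
  then have "card U = (\<Sum>k\<in>{1..n}. card (Pair k -` U))"
    by (subst U_eq, subst card_SigmaI) auto
  also have "\<dots> = n * c"
    using c[OF maximal_independent_set_copies_section[OF U]] by simp
  finally show ?thesis .
qed

section \<open>The graph \<open>B_graph b\<close> and the final count\<close>

text \<open>Each of the two cliques allows at most one vertex, and the matching between them
  excludes equal indices.\<close>

lemma independent_set_B_graph:
  "independent_set (B_graph b) S \<longleftrightarrow> S \<subseteq> Inl ` {1..b} \<union> Inr ` {1..b} \<and>
    (\<forall>i j. Inl i \<in> S \<and> Inl j \<in> S \<longrightarrow> i = j) \<and> (\<forall>i j. Inr i \<in> S \<and> Inr j \<in> S \<longrightarrow> i = j) \<and>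
    (\<forall>i. \<not> (Inl i \<in> S \<and> Inr i \<in> S))"
  (is "?L \<longleftrightarrow> ?R")
proof
  assume S: ?L
  then have sub: "S \<subseteq> Inl ` {1..b} \<union> Inr ` {1..b}" by (simp add: independent_set_def B_graph_def)
  have no: "\<not> e \<subseteq> S" if "e \<in> edges (B_graph b)" for e using S that by (simp add: independent_set_def)
  have "\<not> (Inl i \<in> S \<and> Inl j \<in> S)" "\<not> (Inr i \<in> S \<and> Inr j \<in> S)" if "i < j" for i j
  proof -
    have "{Inl i, Inl j} \<in> edges (B_graph b)" if "Inl i \<in> S" "Inl j \<in> S"
    proof -
      have "1 \<le> i" "j \<le> b" using that sub by auto
      with \<open>i < j\<close> show ?thesis unfolding B_graph_def by simp blast
    qed
    moreover have "{Inr i, Inr j} \<in> edges (B_graph b)" if "Inr i \<in> S" "Inr j \<in> S"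
    proof -
      have "1 \<le> i" "j \<le> b" using that sub by auto
      with \<open>i < j\<close> show ?thesis unfolding B_graph_def by simp blast
    qed
    ultimately show "\<not> (Inl i \<in> S \<and> Inl j \<in> S)" "\<not> (Inr i \<in> S \<and> Inr j \<in> S)"
      using no by fastforce+
  qed
  moreover have "\<not> (Inl i \<in> S \<and> Inr i \<in> S)" for i
  proof
    assume i: "Inl i \<in> S \<and> Inr i \<in> S"
    then have "1 \<le> i" "i \<le> b" using sub by auto
    then have "{Inl i, Inr i} \<in> edges (B_graph b)" unfolding B_graph_def by simp blast
    then show False using no i by fastforce
  qed
  ultimately show ?R using sub by (metis linorder_neqE_nat)
next
  assume R: ?R
  show ?L
    unfolding independent_set_def
  proof (intro conjI ballI)
    show "S \<subseteq> verts (B_graph b)" using R by (simp add: B_graph_def)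
    fix e assume "e \<in> edges (B_graph b)"
    then consider i j where "e = {Inl i, Inl j}" "i < j" | i j where "e = {Inr i, Inr j}" "i < j"
      | i where "e = {Inl i, Inr i}"
      unfolding B_graph_def by simp blast
    then show "\<not> e \<subseteq> S"
    proof cases
      case (1 i j)
      then have "\<not> (Inl i \<in> S \<and> Inl j \<in> S)" using R less_irrefl by metis
      then show ?thesis using 1 by simp
    next
      case (2 i j)
      then have "\<not> (Inr i \<in> S \<and> Inr j \<in> S)" using R less_irrefl by metis
      then show ?thesis using 2 by simp
    qed (use R in simp)
  qed
qed

text \<open>If \<open>S\<close> missed one clique, then, since it has at most one vertex in the
  other, some index different from that vertex's index would supply a vertex to add.\<close>

lemma card_maximal_independent_set_B_graph:
  assumes "b \<ge> 2" and S: "maximal_independent_set (B_graph b) S"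
  shows "card S = 2"
proof -
  have indep: "independent_set (B_graph b) S"
    using S by (simp add: maximal_independent_set_def)
  have max: "v \<in> S" if "independent_set (B_graph b) (insert v S)" for v
    using S that unfolding maximal_independent_set_def by blast
  have other: "\<exists>i\<in>{1..b}. i \<noteq> j" for j
    using assms(1) by (intro bexI[of _ "if j = 1 then 2 else 1"]) auto
  have "\<exists>i. Inl i \<in> S"
  proof (rule ccontr)
    assume no: "\<not> ?thesis"
    obtain i where "i \<in> {1..b}" "Inr i \<notin> S"
      using other indep unfolding independent_set_B_graph by metis
    then have "independent_set (B_graph b) (insert (Inl i) S)"
      using indep no unfolding independent_set_B_graph by auto
    then show False using max no by blast
  qed
  moreover have "\<exists>j. Inr j \<in> S"
  proof (rule ccontr)
    assume no: "\<not> ?thesis"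
    obtain i where "i \<in> {1..b}" "Inl i \<notin> S"
      using other indep unfolding independent_set_B_graph by metis
    then have "independent_set (B_graph b) (insert (Inr i) S)"
      using indep no unfolding independent_set_B_graph by auto
    then show False using max no by blast
  qed
  ultimately obtain i j where "Inl i \<in> S" "Inr j \<in> S" by blast
  then have "S = {Inl i, Inr j}"
    using indep unfolding independent_set_B_graph by blast
  then show ?thesis by simp
qed

text \<open>Maximal independent sets have size \<open>a\<close> on the left and \<open>n * 2\<close>
  on the right, and both sides carry one, so well-coveredness is equality of these numbers.\<close>

lemma well_covered_G_graph:
  assumes "a \<ge> 1" "n \<ge> 1" "b \<ge> 2"
  shows "well_covered (G_graph a b n) \<longleftrightarrow> a = 2 * n"
proof -
  note graphs = finite_simple_graph_edgeless[of a] finite_simple_graph_copies[OF finite_simple_graph_B, of n b]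
  have fin: "finite (verts (G_graph a b n))"
    using finite_simple_graph_G[of a b n] by (simp add: finite_simple_graph_def)
  \<comment> \<open>The side is recorded with the size, so that a single known vertex of
    \<open>T\<close> decides which size applies.\<close>
  have L: "card T = a \<and> T \<subseteq> range Inl \<or> card T = n * 2 \<and> T \<subseteq> range Inr"
    if T: "maximal_independent_set (G_graph a b n) T" for T
    using graphs T[unfolded G_graph_def]
  proof (cases rule: maximal_independent_set_joinE)
    case (1 S)
    then show ?thesis by (auto simp: maximal_independent_set_edgeless card_image)
  next
    case (2 S)
    have "card S = n * 2"
      using 2(1) card_maximal_independent_set_B_graph[OF assms(3)]
      by (rule card_maximal_independent_set_copies[rotated])
        (use finite_simple_graph_B in \<open>simp_all add: finite_simple_graph_def\<close>)
    then show ?thesis using 2(2) by (auto simp: card_image)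
  qed
  \<comment> \<open>Extending a single vertex from each side gives a maximal independent set on that
    side; the bounds on \<open>a\<close>, \<open>n\<close> and \<open>b\<close> ensure that these
    vertices exist.\<close>
  have "independent_set (G_graph a b n) {Inl 1}"
    unfolding G_graph_def independent_set_join[OF graphs]
    using assms by (intro disjI1 exI[of _ "{1}"]) (auto simp: independent_set_def edgeless_graph_def)
  then obtain T\<^sub>1 where T1: "maximal_independent_set (G_graph a b n) T\<^sub>1" "{Inl 1} \<subseteq> T\<^sub>1"
    by (rule independent_set_extends[OF fin])
  have card_T1: "card T\<^sub>1 = a" using L[OF T1(1)] T1(2) by auto
  have "independent_set (copies n (B_graph b)) {(1, Inl 1)}"
    using graphs(2) assms by (auto simp: independent_set_def copies_def B_graph_def finite_simple_graph_def)
  then have "independent_set (G_graph a b n) {Inr (1, Inl 1)}"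
    unfolding G_graph_def independent_set_join[OF graphs] by (intro disjI2 exI[of _ "{(1, Inl 1)}"]) simp
  then obtain T\<^sub>2 where T2: "maximal_independent_set (G_graph a b n) T\<^sub>2" "{Inr (1, Inl 1)} \<subseteq> T\<^sub>2"
    by (rule independent_set_extends[OF fin])
  have card_T2: "card T\<^sub>2 = n * 2" using L[OF T2(1)] T2(2) by auto
  show ?thesis
  proof
    assume "well_covered (G_graph a b n)"
    then have "card T\<^sub>1 = card T\<^sub>2" using T1(1) T2(1) unfolding well_covered_def by blast
    then show "a = 2 * n" by (simp add: card_T1 card_T2)
  next
    assume a: "a = 2 * n"
    have "card T = a" if "maximal_independent_set (G_graph a b n) T" for T
      using L[OF that] a by auto
    then show "well_covered (G_graph a b n)" by (simp add: well_covered_def)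
  qed
qed

theorem theorem6p3:
  fixes a b n :: nat
  assumes "a \<ge> 1" and "n \<ge> 1" and "b \<ge> 3"
  shows "(well_covered (G_graph a b n) \<longleftrightarrow>
            unmixed (poly_ring (verts (G_graph a b n)))
              (edge_ideal (G_graph a b n) :: (nat + nat \<times> (nat + nat), 'k :: field) mpoly set)) \<and>
         (unmixed (poly_ring (verts (G_graph a b n)))
              (edge_ideal (G_graph a b n) :: (nat + nat \<times> (nat + nat), 'k) mpoly set) \<longleftrightarrow>
            pure_complex (independence_complex (G_graph a b n))) \<and>
         (pure_complex (independence_complex (G_graph a b n)) \<longleftrightarrow> a = 2 * n)"
proof -
  have "well_covered (G_graph a b n) \<longleftrightarrow> a = 2 * n"
    using assms by (intro well_covered_G_graph) simp_all
  then show ?thesis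
    unfolding unmixed_edge_ideal_iff[OF finite_simple_graph_G] pure_iff_well_covered by blast
qed

end
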